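(* Let $a>0$ be real, $d\ge2$ an integer, and $v<-\log a$ real. Then any configuration of points $\{x_k\}_{k=1}^d\subset\mathbb{R}$ such that $U^{\tau_d}(ai)=v$ satisfies $$I[\tau_d]\ge 2v+\log(2a)-\frac{\log d}{d-1}. \qquad ( * )$$ If $$v\le\Big(\frac1d-1\Big)\log2-\log a,$$ then equality in $( * )$ is attained if and only if $\{x_k\}_{k=1}^d$ is either the set $$\{a\tan(\gamma+k\pi/d):\ k=0,1,\dots,d-1\}$$ or its reflection with respect to the origin, where, with $m:=e^{-vd}$, $D:=m^{2d-2}d^d/(2a)^{d(d-1)}$ and $p:=a^{d/2}2^{d/2-1}d^{d/(2d-2)}D^{-1/(2d-2)}$, one sets $\gamma=\frac1d\arccos p$ if $d$ is odd and $\gamma=\frac1d\arcsin p$ if $d$ is even. If $$\Big(\frac1d-1\Big)\log2-\log a<v<-\log a,$$ then $$I[\tau_d]\ge-\frac{\log\Delta_G}{d(d-1)}, \qquad ( ** )$$ where $G=G_{a,\lambda_e}$ with the unique $\lambda_e=\lambda_e(a,d,v)>2d-2$ satisfying $$1+\sum_{k=1}^{\lfloor d/2\rfloor}\binom{d}{2k}\frac{(2k-1)!!}{\prod_{j=1}^k(\lambda_e-2d+2j+1)}=\frac{e^{-vd}}{a^d}.$$ Moreover, equality in $( ** )$ is attained if and only if $\{x_k\}_{k=1}^d$ are the roots of $G_{a,\lambda_e}(x)$.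
   Context: For real points $x_1,\dots,x_d$ put $f(x)=\prod_{k=1}^d(x-x_k)$ and $\tau_d=\frac1d\sum_{k=1}^d\delta_{x_k}$, where $\delta_x$ is the unit point mass at $x$. The logarithmic potential is $U^{\tau_d}(z)=-\int\log|z-t|\,d\tau_d(t)=-\frac1d\log|f(z)|$, and the discrete energy is $$I[\tau_d]=-\frac{1}{d(d-1)}\sum_{j\ne k}\log|x_j-x_k|=-\frac1{d(d-1)}\log\Delta_f,\qquad \Delta_f=\prod_{1\le j<k\le d}(x_j-x_k)^2,$$ with the sum over ordered pairs, and $I[\tau_d]=+\infty$ if two points coincide. For a real $\lambda>2d-3$, $$G_{a,\lambda}(x):=x^d+\sum_{k=1}^{\lfloor d/2\rfloor}\left((-1)^ka^{2k}\binom{d}{2k}\frac{(2k-1)!!}{\prod_{j=1}^k(\lambda-2d+2j+1)}\right)x^{d-2k},$$ and $\Delta_G$ denotes the discriminant of $G$. Here $(2k-1)!!=1\cdot3\cdots(2k-1)$ and $i=\sqrt{-1}$. *)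

theory Defs
  imports "HOL-Analysis.Analysis"
begin

text \<open>
  A configuration of \<open>d\<close> real points is a function \<open>x :: nat \<Rightarrow> real\<close>, of which only the values at
  \<open>1, \<dots>, d\<close> matter. Points may coincide.
\<close>

definition counting_prob :: "nat \<Rightarrow> (nat \<Rightarrow> real) \<Rightarrow> real measure" where
  "counting_prob d x = distr (uniform_count_measure {1..d}) borel x"

lemma emeasure_counting_prob:
  assumes "d > 0" and A: "A \<in> sets borel"
  shows "emeasure (counting_prob d x) A = ennreal ((1 / real d) * (\<Sum>k=1..d. indicator A (x k)))"
proof -
  have meas: "x \<in> measurable (uniform_count_measure {1..d}) borel"
    by (auto simp: measurable_def space_uniform_count_measure sets_uniform_count_measure)
  have "emeasure (counting_prob d x) A = emeasure (uniform_count_measure {1..d}) (x -` A \<inter> {1..d})"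
    unfolding counting_prob_def
    by (subst emeasure_distr[OF meas A]) (simp add: space_uniform_count_measure)
  also have "\<dots> = ennreal (real (card (x -` A \<inter> {1..d})) / real d)"
    by (subst emeasure_uniform_count_measure)
       (auto simp: ennreal_of_nat_eq_real_of_nat divide_ennreal assms)
  also have "real (card (x -` A \<inter> {1..d})) = (\<Sum>k=1..d. indicator A (x k))"
    by (simp add: indicator_def sum.If_cases Int_commute vimage_def)
  finally show ?thesis by simp
qed

text \<open>
  In Isabelle \<open>ln 0 = 0\<close>, so the following is the logarithmic potential only at points \<open>z\<close> that
  carry no mass (where the true value is not \<open>\<infinity>\<close>); in particular at all non-real \<open>z\<close>.
\<close>

definition log_potential :: "real measure \<Rightarrow> complex \<Rightarrow> real" where
  "log_potential M z = - (LINT t|M. ln (cmod (z - complex_of_real t)))"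

lemma log_potential_counting_prob:
  assumes "d > 0" and z: "\<And>k. k \<in> {1..d} \<Longrightarrow> z \<noteq> complex_of_real (x k)"
  shows "log_potential (counting_prob d x) z
           = - (1 / real d) * ln (cmod (\<Prod>k=1..d. z - complex_of_real (x k)))"
proof -
  have meas: "x \<in> measurable (uniform_count_measure {1..d}) borel"
    by (auto simp: measurable_def space_uniform_count_measure sets_uniform_count_measure)
  have "(LINT t|counting_prob d x. ln (cmod (z - complex_of_real t)))
          = (LINT k|uniform_count_measure {1..d}. ln (cmod (z - complex_of_real (x k))))"
    unfolding counting_prob_def by (rule integral_distr[OF meas]) measurable
  also have "\<dots> = (\<Sum>k=1..d. ln (cmod (z - complex_of_real (x k)))) / real d"
    by (subst integral_uniform_count_measure) auto
  also have "(\<Sum>k=1..d. ln (cmod (z - complex_of_real (x k))))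
               = ln (cmod (\<Prod>k=1..d. z - complex_of_real (x k)))"
    unfolding prod_norm[symmetric] by (subst ln_prod) (use z in auto)
  finally show ?thesis by (simp add: log_potential_def)
qed

definition discrete_energy :: "nat \<Rightarrow> (nat \<Rightarrow> real) \<Rightarrow> ereal" where
  "discrete_energy d x =
     (if inj_on x {1..d}
      then ereal (- (1 / (real d * (real d - 1)))
                    * (\<Sum>j\<in>{1..d}. \<Sum>k\<in>{1..d} - {j}. ln \<bar>x j - x k\<bar>))
      else \<infinity>)"

text \<open>
  The discriminant of a real polynomial \<open>p\<close> of degree \<open>n\<close> is
  \<open>c\<^sup>2\<^sup>n\<^sup>-\<^sup>2 \<Prod>\<^sub>j\<^sub><\<^sub>k (r\<^sub>j - r\<^sub>k)\<^sup>2\<close> for the leading coefficient \<open>c\<close> and the complex roots \<open>r\<^sub>1, \<dots>, r\<^sub>n\<close>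
  listed with multiplicity. To avoid choosing an order of the roots, the product is taken over
  ordered pairs, which gives \<open>(-1)\<^sup>n\<^sup>(\<^sup>n\<^sup>-\<^sup>1\<^sup>)\<^sup>/\<^sup>2 \<Prod>\<^sub>j\<^sub><\<^sub>k (r\<^sub>j - r\<^sub>k)\<^sup>2\<close>. The result is a real number, and
  \<open>Re\<close> only serves to view it as one.
\<close>

definition discriminant :: "real poly \<Rightarrow> real" where
  "discriminant p =
     (let n = degree p; R = proots (map_poly complex_of_real p)
      in lead_coeff p ^ (2 * n - 2) * (-1) ^ (n * (n - 1) div 2)
           * Re (\<Prod>r\<in>#R. \<Prod>s\<in>#R - {#r#}. r - s))"

lemma prod_offdiag_swap:
  fixes d :: nat and x :: "nat \<Rightarrow> real"
  shows "(\<Prod>j\<in>{1..d}. \<Prod>k\<in>{1..d} - {j}. x j - x k)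
           = (-1) ^ (d * (d - 1) div 2) * (\<Prod>j\<in>{1..d}. \<Prod>k\<in>{j<..d}. (x j - x k)\<^sup>2)"
proof (induction d)
  case 0
  show ?case by simp
next
  case (Suc d)
  have S: "{1..Suc d} = insert (Suc d) {1..d}" by auto
  have inner: "(\<Prod>k\<in>{1..Suc d} - {j}. x j - x k)
                 = (x j - x (Suc d)) * (\<Prod>k\<in>{1..d} - {j}. x j - x k)" if "j \<in> {1..d}" for j
  proof -
    have "{1..Suc d} - {j} = insert (Suc d) ({1..d} - {j})" using that by auto
    thus ?thesis by simp
  qed
  have last: "{1..Suc d} - {Suc d} = {1..d}" by auto
  have neg: "(\<Prod>k\<in>{1..d}. x (Suc d) - x k) = (-1) ^ d * (\<Prod>k\<in>{1..d}. x k - x (Suc d))"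
  proof -
    have "(\<Prod>k\<in>{1..d}. x (Suc d) - x k) = (\<Prod>k\<in>{1..d}. (-1) * (x k - x (Suc d)))"
      by simp
    also have "\<dots> = (-1) ^ d * (\<Prod>k\<in>{1..d}. x k - x (Suc d))"
      by (subst prod.distrib) simp
    finally show ?thesis .
  qed
  have L: "(\<Prod>j\<in>{1..Suc d}. \<Prod>k\<in>{1..Suc d} - {j}. x j - x k)
        = (-1) ^ d * (\<Prod>k\<in>{1..d}. (x k - x (Suc d))\<^sup>2) *
          (\<Prod>j\<in>{1..d}. \<Prod>k\<in>{1..d} - {j}. x j - x k)"
  proof -
    have "(\<Prod>j\<in>{1..Suc d}. \<Prod>k\<in>{1..Suc d} - {j}. x j - x k)
        = (\<Prod>k\<in>{1..d}. x (Suc d) - x k) * (\<Prod>j\<in>{1..d}. \<Prod>k\<in>{1..Suc d} - {j}. x j - x k)"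
      by (subst S, subst prod.insert) (simp_all only: last finite_atLeastAtMost, auto)
    also have "(\<Prod>j\<in>{1..d}. \<Prod>k\<in>{1..Suc d} - {j}. x j - x k)
        = (\<Prod>j\<in>{1..d}. (x j - x (Suc d)) * (\<Prod>k\<in>{1..d} - {j}. x j - x k))"
      by (intro prod.cong refl inner)
    also have "\<dots> = (\<Prod>j\<in>{1..d}. x j - x (Suc d)) * (\<Prod>j\<in>{1..d}. \<Prod>k\<in>{1..d} - {j}. x j - x k)"
      by (rule prod.distrib)
    finally show ?thesis
      unfolding neg by (simp only: prod.distrib power2_eq_square mult_ac)
  qed
  have R: "(\<Prod>j\<in>{1..Suc d}. \<Prod>k\<in>{j<..Suc d}. (x j - x k)\<^sup>2)
        = (\<Prod>k\<in>{1..d}. (x k - x (Suc d))\<^sup>2) * (\<Prod>j\<in>{1..d}. \<Prod>k\<in>{j<..d}. (x j - x k)\<^sup>2)"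
  proof -
    have "(\<Prod>j\<in>{1..Suc d}. \<Prod>k\<in>{j<..Suc d}. (x j - x k)\<^sup>2)
        = (\<Prod>j\<in>{1..d}. \<Prod>k\<in>{j<..Suc d}. (x j - x k)\<^sup>2)"
      by (subst S, subst prod.insert) simp_all
    also have "\<dots> = (\<Prod>j\<in>{1..d}. (x j - x (Suc d))\<^sup>2 * (\<Prod>k\<in>{j<..d}. (x j - x k)\<^sup>2))"
    proof (intro prod.cong refl)
      fix j assume "j \<in> {1..d}"
      hence "{j<..Suc d} = insert (Suc d) {j<..d}" by auto
      thus "(\<Prod>k\<in>{j<..Suc d}. (x j - x k)\<^sup>2) = (x j - x (Suc d))\<^sup>2 * (\<Prod>k\<in>{j<..d}. (x j - x k)\<^sup>2)"
        by simp
    qed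
    finally show ?thesis by (simp add: prod.distrib)
  qed
  have "Suc d * (Suc d - 1) div 2 = d + d * (d - 1) div 2"
    by (cases d) (auto simp: algebra_simps)
  thus ?case
    unfolding L R Suc.IH by (simp add: power_add mult_ac)
qed

lemma discriminant_real_roots:
  fixes x :: "nat \<Rightarrow> real"
  shows "discriminant (\<Prod>k=1..d. [:- x k, 1:]) = (\<Prod>j\<in>{1..d}. \<Prod>k\<in>{j<..d}. (x j - x k)\<^sup>2)"
proof -
  define p where "p = (\<Prod>k=1..d. [:- x k, 1:])"
  define M where "M = mset_set {1..d}"
  have deg: "degree p = d" unfolding p_def by (subst degree_prod_sum_eq) auto
  have lc: "lead_coeff p = 1" unfolding p_def by (simp add: lead_coeff_prod)
  have mult: "map_poly complex_of_real (q * r) = map_poly complex_of_real q * map_poly complex_of_real r"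
    for q r :: "real poly"
    by (intro poly_eqI) (simp add: coeff_map_poly coeff_mult)
  have "map_poly complex_of_real (\<Prod>k\<in>A. [:- x k, 1:]) = (\<Prod>k\<in>A. [:- complex_of_real (x k), 1:])"
    if "finite A" for A
    using that by (induction A rule: finite_induct) 
      (simp_all only: prod.insert prod.empty mult not_False_eq_True,
       simp_all only: map_poly_pCons one_pCons map_poly_0 of_real_minus of_real_0 of_real_1 refl)
  hence "map_poly complex_of_real p = (\<Prod>k=1..d. [:- complex_of_real (x k), 1:])"
    unfolding p_def by blast
  moreover have sing: "(\<Sum>k\<in>A. {#complex_of_real (x k)#}) = image_mset (\<lambda>k. complex_of_real (x k)) (mset_set A)"
    if "finite A" for A :: "nat set"
    using that by (induction A rule: finite_induct) auto
  ultimately have R: "proots (map_poly complex_of_real p) = image_mset (\<lambda>k. complex_of_real (x k)) M"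
    unfolding M_def using sing[of "{1..d}"] by (simp add: proots_prod)
  have "(\<Prod>r\<in>#image_mset (\<lambda>k. complex_of_real (x k)) M.
           \<Prod>s\<in>#image_mset (\<lambda>k. complex_of_real (x k)) M - {#r#}. r - s)
        = (\<Prod>j\<in>{1..d}. \<Prod>s\<in>#image_mset (\<lambda>k. complex_of_real (x k)) M - {#complex_of_real (x j)#}.
             complex_of_real (x j) - s)"
    by (simp add: M_def prod_unfold_prod_mset image_mset.compositionality o_def)
  also have "\<dots> = (\<Prod>j\<in>{1..d}. \<Prod>k\<in>{1..d} - {j}. complex_of_real (x j) - complex_of_real (x k))"
  proof (intro prod.cong refl)
    fix j assume j: "j \<in> {1..d}"
    hence "M = add_mset j (mset_set ({1..d} - {j}))"
      unfolding M_def by (simp add: mset_set.remove)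
    thus "(\<Prod>s\<in>#image_mset (\<lambda>k. complex_of_real (x k)) M - {#complex_of_real (x j)#}.
             complex_of_real (x j) - s)
          = (\<Prod>k\<in>{1..d} - {j}. complex_of_real (x j) - complex_of_real (x k))"
      by (simp add: prod_unfold_prod_mset image_mset.compositionality o_def)
  qed
  also have "\<dots> = complex_of_real (\<Prod>j\<in>{1..d}. \<Prod>k\<in>{1..d} - {j}. x j - x k)"
    by simp
  finally show ?thesis
    unfolding p_def[symmetric] discriminant_def Let_def R lc
    by (simp only: Re_complex_of_real prod_offdiag_swap deg)
       (simp add: mult.assoc[symmetric] power_mult_distrib[symmetric])
qed

lemma discrete_energy_eq_discriminant:
  assumes inj: "inj_on x {1..d}"
  shows "discrete_energy d x
           = ereal (- ln (discriminant (\<Prod>k=1..d. [:- x k, 1:])) / (real d * (real d - 1)))"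
proof -
  have "discriminant (\<Prod>k=1..d. [:- x k, 1:]) = \<bar>\<Prod>j\<in>{1..d}. \<Prod>k\<in>{1..d} - {j}. x j - x k\<bar>"
    unfolding prod_offdiag_swap discriminant_real_roots abs_mult
    by (simp add: abs_prod power_abs)
  also have "ln \<dots> = (\<Sum>j\<in>{1..d}. \<Sum>k\<in>{1..d} - {j}. ln \<bar>x j - x k\<bar>)"
  proof -
    have nz: "\<bar>x j - x k\<bar> > 0" if "j \<in> {1..d}" "k \<in> {1..d} - {j}" for j k
      using inj_onD[OF inj, of j k] that by auto
    have "ln (\<Prod>j\<in>{1..d}. \<Prod>k\<in>{1..d} - {j}. \<bar>x j - x k\<bar>)
            = (\<Sum>j\<in>{1..d}. ln (\<Prod>k\<in>{1..d} - {j}. \<bar>x j - x k\<bar>))"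
      by (rule ln_prod, simp, rule less_imp_neq[symmetric, OF prod_pos], use nz in blast)
    also have "\<dots> = (\<Sum>j\<in>{1..d}. \<Sum>k\<in>{1..d} - {j}. ln \<bar>x j - x k\<bar>)"
      by (intro sum.cong refl ln_prod) (use nz in auto)
    finally show ?thesis by (simp only: abs_prod)
  qed
  finally show ?thesis using inj by (simp add: discrete_energy_def)
qed

definition G_coeff :: "real \<Rightarrow> nat \<Rightarrow> nat \<Rightarrow> real" where
  "G_coeff l d k = real (d choose (2 * k)) * (\<Prod>j=1..k. 2 * real j - 1)
                     / (\<Prod>j=1..k. l - 2 * real d + 2 * real j + 1)"

definition G_poly :: "nat \<Rightarrow> real \<Rightarrow> real \<Rightarrow> real poly" where
  "G_poly d a l = monom 1 d
     + (\<Sum>k=1..d div 2. monom ((-1) ^ k * a ^ (2 * k) * G_coeff l d k) (d - 2 * k))"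

definition is_lambda_e :: "real \<Rightarrow> nat \<Rightarrow> real \<Rightarrow> real \<Rightarrow> bool" where
  "is_lambda_e a d v l \<longleftrightarrow>
     l > 2 * real d - 2 \<and> 1 + (\<Sum>k=1..d div 2. G_coeff l d k) = exp (- v * real d) / a ^ d"

definition tan_gamma :: "real \<Rightarrow> nat \<Rightarrow> real \<Rightarrow> real" where
  "tan_gamma a d v =
     (let m = exp (- v * real d);
          D = m ^ (2 * d - 2) * real d ^ d / (2 * a) ^ (d * (d - 1));
          p = a powr (real d / 2) * 2 powr (real d / 2 - 1)
                * real d powr (real d / (2 * real d - 2)) * D powr (- 1 / (2 * real d - 2))
      in (if odd d then arccos p / real d else arcsin p / real d))"

definition tan_points :: "real \<Rightarrow> nat \<Rightarrow> real \<Rightarrow> real set" where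
  "tan_points a d v = (\<lambda>k. a * tan (tan_gamma a d v + real k * pi / real d)) ` {0..d - 1}"

end

theory Submission
  imports Defs
begin

text \<open>
  Substitute \<open>x\<^sub>k = a tan \<theta>\<^sub>k\<close>. The constraint fixes \<open>\<Sum> ln (cos \<theta>\<^sub>k)\<close>, and up to terms that it fixes
  the energy is \<open>-\<Sum> ln \<bar>sin (\<theta>\<^sub>k - \<theta>\<^sub>j)\<bar>\<close>. For sorted angles,
  \<open>\<Sum> ln \<bar>sin (\<theta>\<^sub>k - \<theta>\<^sub>j)\<bar> + s \<Sum> ln (cos \<theta>\<^sub>k)\<close> with \<open>s \<ge> 0\<close> is concave on a convex set, so every critical
  point is a maximum, unique for \<open>s > 0\<close> and unique up to rotation for \<open>s = 0\<close>.

  For \<open>s = 0\<close> the critical points are the equally spaced angles; \<open>\<Prod> cos (t + k\<pi>/d)\<close> is known in closed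
  form, and the constraint can be met exactly when \<open>v\<close> is at most the threshold. Above the threshold
  put \<open>s = \<lambda> - 2d + 2 > 0\<close>: critical points are then the real zeros of polynomial solutions of
  \<open>(a\<^sup>2 + x\<^sup>2) G'' - \<lambda> x G' + d (\<lambda> - d + 1) G = 0\<close>, i.e. of \<open>G\<^bsub>a,\<lambda>\<^esub>\<close>, and \<open>\<lambda>\<^sub>e\<close> is the parameter for which
  \<open>\<bar>G(ai)\<bar> = e\<^bsup>-vd\<^esup>\<close>. That \<open>G\<close> has \<open>d\<close> simple real zeros follows by induction from
  \<open>G\<^bsub>d+1,\<lambda>+2\<^esub>' = (d + 1) G\<^bsub>d,\<lambda>\<^esub>\<close> and the differential equation.
\<close>

section \<open>Maximality of critical angles\<close>

text \<open>The derivative \<open>cot\<close> of ln sin is strictly decreasing on (0, pi), because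
  cot r - cot s = sin (s - r) / (sin r * sin s); the mean value theorem between \<open>u\<close> and
  \<open>w\<close> turns this into the strict tangent inequality.\<close>

lemma ln_sin_less_tangent:
  fixes u w :: real
  assumes "0 < u" "u < pi" "0 < w" "w < pi" "u \<noteq> w"
  shows "ln (sin u) < ln (sin w) + cot w * (u - w)"
proof -
  let ?g = "\<lambda>t. ln (sin t) - cot w * t"
  have D: "(?g has_real_derivative (cot t - cot w)) (at t)" if "0 < t" "t < pi" for t
    using sin_gt_zero[OF that] sin_gt_zero[of w] assms by (auto intro!: derivative_eq_intros simp: cot_def)
  have cot_less: "cot s < cot r" if "0 < r" "r < s" "s < pi" for r s :: real
  proof -
    have "sin (s - r) > 0" "sin r > 0" "sin s > 0"
      using that by (auto intro!: sin_gt_zero)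
    then show ?thesis
      by (simp add: cot_def divide_simps sin_diff mult_ac)
  qed
  have "?g u < ?g w"
  proof (cases "u < w")
    case True
    obtain t where t: "t > u" "t < w" "?g w - ?g u = (w - u) * (cot t - cot w)"
      using MVT2[OF True, of ?g "\<lambda>t. cot t - cot w"] D assms by force
    have "(w - u) * (cot t - cot w) > 0"
      using cot_less[of t w] t assms True by simp
    with t show ?thesis by linarith
  next
    case False
    then have wu: "w < u" using assms by simp
    obtain t where t: "t > w" "t < u" "?g u - ?g w = (u - w) * (cot t - cot w)"
      using MVT2[OF wu, of ?g "\<lambda>t. cot t - cot w"] D assms by force
    have "(u - w) * (cot t - cot w) < 0"
      using cot_less[of w t] t assms wu by (simp add: mult_less_0_iff)
    with t show ?thesis by linarith
  qed
  then show ?thesis by (simp add: algebra_simps)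
qed

text \<open>ln |sin| is concave on each side of its singularity at 0 but not across it, so both
  angles must have the same sign. Negative angles reduce to positive ones by reflection, under which
  \<open>cot w\<close> and \<open>u - w\<close> both change sign.\<close>

lemma ln_abs_sin_less_tangent:
  fixes u w :: real
  assumes "0 < \<bar>u\<bar>" "\<bar>u\<bar> < pi" "0 < \<bar>w\<bar>" "\<bar>w\<bar> < pi" "u > 0 \<longleftrightarrow> w > 0" "u \<noteq> w"
  shows "ln \<bar>sin u\<bar> < ln \<bar>sin w\<bar> + cot w * (u - w)"
proof (cases "u > 0")
  case True
  then have "sin u > 0" "sin w > 0" using assms by (auto intro!: sin_gt_zero)
  then show ?thesis using ln_sin_less_tangent[of u w] assms True by simp
next
  case False
  then have "sin (-u) > 0" "sin (-w) > 0" using assms by (auto intro!: sin_gt_zero simp del: sin_minus)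
  then show ?thesis using ln_sin_less_tangent[of "-u" "-w"] assms False
    by (simp add: cot_def diff_divide_distrib algebra_simps)
qed

lemma ln_cos_less_tangent:
  fixes u w :: real
  assumes "\<bar>u\<bar> < pi / 2" "\<bar>w\<bar> < pi / 2" "u \<noteq> w"
  shows "ln (cos u) < ln (cos w) - tan w * (u - w)"
  using ln_sin_less_tangent[of "u + pi/2" "w + pi/2"] assms
  by (auto simp: sin_add cos_add cot_def tan_def)

text \<open>
  The diagonal contributes nothing, since \<open>ln \<bar>sin 0\<bar> = 0\<close>.
\<close>

definition sin_energy :: "nat \<Rightarrow> (nat \<Rightarrow> real) \<Rightarrow> real" where
  "sin_energy d \<theta> = (\<Sum>k<d. \<Sum>j<d. ln \<bar>sin (\<theta> k - \<theta> j)\<bar>)"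

text \<open>Fixing the order makes the admissible set convex: every difference
  \<open>\<theta> k - \<theta> j\<close> with \<open>j \<noteq> k\<close> keeps its sign and stays
  in (-pi, pi), off the singularities of ln |sin|.\<close>

definition ordered_angles :: "nat \<Rightarrow> (nat \<Rightarrow> real) \<Rightarrow> bool" where
  "ordered_angles d \<theta> \<longleftrightarrow> strict_mono_on {..<d} \<theta> \<and> (\<forall>k<d. \<bar>\<theta> k\<bar> < pi / 2)"

text \<open>
  Both \<open>ln sin\<close> on \<open>(0, \<pi>)\<close> and \<open>ln cos\<close> on \<open>(-\<pi>/2, \<pi>/2)\<close> lie below their tangents, and the
  tangent terms at \<open>\<phi>\<close> cancel because \<open>\<phi>\<close> is critical.
\<close>

lemma critical_angles_maximal:
  assumes \<theta>: "ordered_angles d \<theta>" and \<phi>: "ordered_angles d \<phi>" and s: "s \<ge> 0"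
    and crit: "\<And>k. k < d \<Longrightarrow> 2 * (\<Sum>j<d. cot (\<phi> k - \<phi> j)) = s * tan (\<phi> k)"
  defines "E \<equiv> \<lambda>\<theta>. sin_energy d \<theta> + s * (\<Sum>k<d. ln (cos (\<theta> k)))"
  shows "E \<theta> \<le> E \<phi>"
    and "E \<theta> = E \<phi> \<Longrightarrow> j < d \<Longrightarrow> k < d \<Longrightarrow> \<theta> k - \<theta> j = \<phi> k - \<phi> j"
    and "E \<theta> = E \<phi> \<Longrightarrow> s > 0 \<Longrightarrow> k < d \<Longrightarrow> \<theta> k = \<phi> k"
proof -
  define h where "h k = \<theta> k - \<phi> k" for k
  \<comment> \<open>\<open>A\<close> and \<open>B\<close> are the gaps in the tangent inequalities
    for a pair and for a single angle; on the diagonal \<open>A\<close> is 0.\<close>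
  define A where "A k j = ln \<bar>sin (\<phi> k - \<phi> j)\<bar> + cot (\<phi> k - \<phi> j) * (h k - h j)
                           - ln \<bar>sin (\<theta> k - \<theta> j)\<bar>" for k j
  define B where "B k = ln (cos (\<phi> k)) - tan (\<phi> k) * h k - ln (cos (\<theta> k))" for k
  have A: "A k j \<ge> 0 \<and> (A k j = 0 \<longrightarrow> \<theta> k - \<theta> j = \<phi> k - \<phi> j)" if "k < d" "j < d" for k j
  proof (cases "k = j \<or> \<theta> k - \<theta> j = \<phi> k - \<phi> j")
    case True
    then have "h k = h j" by (auto simp: h_def)
    with True show ?thesis by (auto simp: A_def)
  next
    case False
    have *: "\<theta> j < \<theta> k \<longleftrightarrow> \<phi> j < \<phi> k" "\<theta> j \<noteq> \<theta> k" "\<phi> j \<noteq> \<phi> k"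
      using False that \<theta> \<phi> strict_mono_on_less[of "{..<d}" \<theta> j k]
        strict_mono_on_less[of "{..<d}" \<phi> j k]
      by (auto simp: ordered_angles_def dest: strict_mono_on_eqD)
    have b: "\<bar>\<theta> k\<bar> < pi/2" "\<bar>\<theta> j\<bar> < pi/2" "\<bar>\<phi> k\<bar> < pi/2" "\<bar>\<phi> j\<bar> < pi/2"
      using that \<theta> \<phi> by (auto simp: ordered_angles_def)
    have "ln \<bar>sin (\<theta> k - \<theta> j)\<bar> < ln \<bar>sin (\<phi> k - \<phi> j)\<bar>
            + cot (\<phi> k - \<phi> j) * ((\<theta> k - \<theta> j) - (\<phi> k - \<phi> j))"
      by (rule ln_abs_sin_less_tangent) (use * b False in auto)
    also have "(\<theta> k - \<theta> j) - (\<phi> k - \<phi> j) = h k - h j" by (simp add: h_def)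
    finally show ?thesis by (simp add: A_def)
  qed
  have B: "B k \<ge> 0 \<and> (B k = 0 \<longrightarrow> \<theta> k = \<phi> k)" if "k < d" for k
    using ln_cos_less_tangent[of "\<theta> k" "\<phi> k"] that \<theta> \<phi>
    by (cases "\<theta> k = \<phi> k") (auto simp: B_def h_def ordered_angles_def)
  have anti: "cot (\<phi> k - \<phi> j) = - cot (\<phi> j - \<phi> k)" for j k
  proof -
    have "\<phi> k - \<phi> j = - (\<phi> j - \<phi> k)" by simp
    then show ?thesis unfolding cot_def by (simp only: sin_minus cos_minus)
  qed
  \<comment> \<open>Antisymmetry of \<open>cot\<close> lets both halves of \<open>h k - h j\<close>
    be collected on \<open>h k\<close>, which produces the factor 2 of \<open>crit\<close>.\<close>
  have "(\<Sum>k<d. \<Sum>j<d. cot (\<phi> k - \<phi> j) * h j) = (\<Sum>j<d. \<Sum>k<d. cot (\<phi> k - \<phi> j) * h j)"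
    by (rule sum.swap)
  also have "\<dots> = (\<Sum>j<d. \<Sum>k<d. - (cot (\<phi> j - \<phi> k) * h j))"
    by (intro sum.cong refl) (metis anti mult_minus_left)
  also have "\<dots> = - (\<Sum>k<d. \<Sum>j<d. cot (\<phi> k - \<phi> j) * h k)"
    by (simp add: sum_negf)
  finally have swap: "(\<Sum>k<d. \<Sum>j<d. cot (\<phi> k - \<phi> j) * h j) = \<dots>" .
  have "(\<Sum>k<d. \<Sum>j<d. cot (\<phi> k - \<phi> j) * (h k - h j))
          = (\<Sum>k<d. h k * (2 * (\<Sum>j<d. cot (\<phi> k - \<phi> j))))"
    using swap by (simp add: algebra_simps sum_subtractf sum.distrib sum_distrib_left)
  also have "\<dots> = (\<Sum>k<d. h k * (s * tan (\<phi> k)))"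
    by (intro sum.cong refl) (simp only: crit lessThan_iff)
  also have "\<dots> = s * (\<Sum>k<d. tan (\<phi> k) * h k)"
    by (simp add: sum_distrib_left mult_ac)
  finally have cancel: "(\<Sum>k<d. \<Sum>j<d. cot (\<phi> k - \<phi> j) * (h k - h j)) = \<dots>" .
  \<comment> \<open>With the linear terms gone, the nonnegative gaps add up exactly to the energy
    deficit, so equality forces the \<open>A\<close> gaps to vanish; the \<open>B\<close> gaps are
    weighted by \<open>s\<close> and follow only for \<open>s > 0\<close>.\<close>
  have slack: "(\<Sum>k<d. \<Sum>j<d. A k j) + s * (\<Sum>k<d. B k) = E \<phi> - E \<theta>"
    using cancel
    by (simp add: A_def B_def E_def sin_energy_def sum.distrib sum_subtractf algebra_simps)
  have A': "(\<Sum>j<d. A k j) \<ge> 0" if "k < d" for k using A that by (intro sum_nonneg) auto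
  have nonneg: "(\<Sum>k<d. \<Sum>j<d. A k j) \<ge> 0" "(\<Sum>k<d. B k) \<ge> 0"
    by (rule sum_nonneg, simp add: A' B)+
  then show "E \<theta> \<le> E \<phi>" using slack s
    by (smt (verit) mult_nonneg_nonneg)
  assume "E \<theta> = E \<phi>"
  then have z: "(\<Sum>k<d. \<Sum>j<d. A k j) = 0 \<and> s * (\<Sum>k<d. B k) = 0"
    using slack nonneg s by (smt (verit) mult_nonneg_nonneg)
  {
    assume "j < d" "k < d"
    have "(\<Sum>j<d. A k j) = 0"
      using z A' \<open>k < d\<close> sum_nonneg_eq_0_iff[of "{..<d}" "\<lambda>k. \<Sum>j<d. A k j"] by auto
    then have "A k j = 0"
      using A \<open>j < d\<close> \<open>k < d\<close> sum_nonneg_eq_0_iff[of "{..<d}" "A k"] by auto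
    then show "\<theta> k - \<theta> j = \<phi> k - \<phi> j" using A \<open>j < d\<close> \<open>k < d\<close> by blast
  }
  {
    assume "s > 0" "k < d"
    then have "(\<Sum>k<d. B k) = 0" using z by simp
    then have "B k = 0"
      using B \<open>k < d\<close> sum_nonneg_eq_0_iff[of "{..<d}" B] by auto
    then show "\<theta> k = \<phi> k" using B \<open>k < d\<close> by blast
  }
qed

section \<open>Trigonometric products and roots of unity\<close>

text \<open>Splitting off one factor, P = (X - r k) * Q, gives P' = Q and P'' = 2 * Q' at that root,
  and Q' / Q is the sum of reciprocals. This is how a differential equation for P becomes an
  equilibrium condition on its roots.\<close>

lemma poly_pderiv_prod_linear:
  fixes r :: "'b \<Rightarrow> 'a :: field"
  assumes "finite A" "inj_on r A" "k \<in> A"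
  defines "P \<equiv> \<Prod>j\<in>A. [:- r j, 1:]"
  shows "poly (pderiv P) (r k) = (\<Prod>j\<in>A - {k}. r k - r j)"
    and "poly (pderiv (pderiv P)) (r k)
           = 2 * poly (pderiv P) (r k) * (\<Sum>j\<in>A - {k}. 1 / (r k - r j))"
proof -
  define Q where "Q = (\<Prod>j\<in>A - {k}. [:- r j, 1:])"
  have P: "P = [:- r k, 1:] * Q"
    unfolding P_def Q_def by (rule prod.remove) fact+
  have P': "pderiv P = [:- r k, 1:] * pderiv Q + Q"
    unfolding P pderiv_mult by (simp add: pderiv_pCons)
  have P'': "pderiv (pderiv P) = [:- r k, 1:] * pderiv (pderiv Q) + 2 * pderiv Q"
    unfolding P' pderiv_add pderiv_mult by (simp add: pderiv_pCons)
  have Q: "poly Q (r k) = (\<Prod>j\<in>A - {k}. r k - r j)"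
    by (simp add: Q_def poly_prod)
  show first: "poly (pderiv P) (r k) = (\<Prod>j\<in>A - {k}. r k - r j)"
    unfolding P' by (simp add: Q)
  have "poly (pderiv Q) (r k) = (\<Sum>i\<in>A - {k}. \<Prod>j\<in>A - {k} - {i}. r k - r j)"
    unfolding Q_def pderiv_prod by (simp add: poly_sum poly_prod pderiv_pCons)
  also have "\<dots> = (\<Sum>i\<in>A - {k}. (\<Prod>j\<in>A - {k}. r k - r j) * (1 / (r k - r i)))"
  proof (intro sum.cong refl)
    fix i assume i: "i \<in> A - {k}"
    then have "r k - r i \<noteq> 0" using assms by (auto dest: inj_onD)
    then show "(\<Prod>j\<in>A - {k} - {i}. r k - r j) = (\<Prod>j\<in>A - {k}. r k - r j) * (1 / (r k - r i))"
      using i assms prod.remove[of "A - {k}" i "\<lambda>j. r k - r j"] by simp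
  qed
  finally show "poly (pderiv (pderiv P)) (r k)
      = 2 * poly (pderiv P) (r k) * (\<Sum>j\<in>A - {k}. 1 / (r k - r j))"
    unfolding first unfolding P'' by (simp add: sum_distrib_left)
qed

text \<open>Both sides are monic of degree \<open>n\<close> and vanish at the \<open>n\<close>
  distinct roots of unity.\<close>

lemma prod_roots_of_unity:
  assumes "n > 0"
  shows "(\<Prod>k<n. [:- cis (2 * pi * real k / real n), 1:]) = monom 1 n - 1"
    (is "?P = _")
proof (rule poly_eqI_degree_lead_coeff[where n = n and A = "{z. z ^ n = 1}"])
  show "card {z::complex. z ^ n = 1} \<ge> n" using card_roots_unity_eq[OF assms] by simp
  have deg: "degree ?P = n" by (subst degree_prod_sum_eq) auto
  have lc: "lead_coeff ?P = 1" by (simp add: lead_coeff_prod)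
  show "degree ?P \<le> n" using deg by simp
  show "degree (monom 1 n - 1 :: complex poly) \<le> n"
    by (intro degree_diff_le) (auto simp: degree_monom_le)
  show "coeff ?P n = coeff (monom 1 n - 1) n" using deg lc assms by simp
  fix z :: complex assume "z \<in> {z. z ^ n = 1}"
  then show "poly ?P z = poly (monom 1 n - 1) z"
    using Complex.bij_betw_roots_unity[OF assms]
    by (auto simp: bij_betw_def poly_prod poly_monom prod_zero_iff)
qed

text \<open>Doubling the angles turns sines of differences into chords of the unit circle, so
  products of sines become values of polynomials in \<open>cis\<close>.\<close>

lemma cis_diff: "cis (2 * s) - cis (2 * t) = 2 * \<i> * of_real (sin (s - t)) * cis (s + t)"
proof -
  have "sin (s - t) * sin (s + t) = (cos (2 * t) - cos (2 * s)) / 2"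
    "sin (s - t) * cos (s + t) = (sin (2 * s) - sin (2 * t)) / 2"
    using sin_times_sin[of "s - t" "s + t"] sin_times_cos[of "s - t" "s + t"]
      cos_minus[of "2 * t"] sin_minus[of "2 * t"] by simp_all
  then show ?thesis by (auto simp: complex_eq_iff)
qed

lemma cmod_cis_diff: "cmod (cis (2 * s) - cis (2 * t)) = 2 * \<bar>sin (s - t)\<bar>"
  by (simp add: cis_diff norm_mult)

text \<open>Evaluate X^n - 1, factored over the roots of unity, at \<open>cis (2 * (- t))\<close>:
  each factor is a chord of length 2 |sin|, and so is the value.\<close>

lemma abs_prod_sin_shift:
  assumes "n > 0"
  shows "(\<Prod>k<n. \<bar>sin (t + real k * pi / real n)\<bar>) = \<bar>sin (real n * t)\<bar> / 2 ^ (n - 1)"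
proof -
  have "(\<Prod>k<n. cis (2 * (- t)) - cis (2 * (pi * real k / real n)))
          = cis (2 * (- (real n * t))) - cis (2 * 0)"
    using arg_cong[OF prod_roots_of_unity[OF assms], of "\<lambda>p. poly p (cis (2 * (- t)))"]
      Complex.DeMoivre[of "2 * (- t)" n]
    by (simp add: poly_prod poly_monom mult_ac)
  then have "(\<Prod>k<n. cmod (cis (2 * (- t)) - cis (2 * (pi * real k / real n))))
          = cmod (cis (2 * (- (real n * t))) - cis (2 * 0))"
    by (simp only: prod_norm)
  then have "(\<Prod>k<n. 2 * \<bar>sin (- t - pi * real k / real n)\<bar>) = 2 * \<bar>sin (- (real n * t) - 0)\<bar>"
    by (simp only: cmod_cis_diff)
  moreover have "\<bar>sin (- t - pi * real k / real n)\<bar> = \<bar>sin (t + real k * pi / real n)\<bar>" for k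
    using sin_minus[of "t + real k * pi / real n"] by (simp add: mult.commute)
  ultimately have "2 ^ n * (\<Prod>k<n. \<bar>sin (t + real k * pi / real n)\<bar>) = 2 * \<bar>sin (real n * t)\<bar>"
    by (simp add: prod.distrib)
  moreover have "(2::real) ^ n = 2 * 2 ^ (n - 1)" using assms by (cases n) auto
  ultimately show ?thesis by (simp add: field_simps)
qed

lemma inj_on_cis_roots:
  assumes "n > 0"
  shows "inj_on (\<lambda>k. cis (2 * pi * real k / real n)) {..<n}"
  using Complex.bij_betw_roots_unity[OF assms] by (simp add: bij_betw_def)

text \<open>For P = X^n - 1 with roots w_j, |P'(w_k)| = n gives the product of chords. The quotient
  P'' / (2 P') at w_k is the sum of 1 / (w_k - w_j). Since w_k / (w_k - w_j) = 1/2 - (i/2) * cot of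
  the angle difference, and these terms add up to the real number (n - 1) / 2, the cotangents
  cancel.\<close>

lemma
  assumes k: "k < n"
  shows abs_prod_sin_diff:
      "(\<Prod>j\<in>{..<n} - {k}. \<bar>sin (real k * pi / real n - real j * pi / real n)\<bar>) = real n / 2 ^ (n - 1)"
    and sum_cot_diff: "(\<Sum>j<n. cot (real k * pi / real n - real j * pi / real n)) = 0"
proof -
  define \<alpha> where "\<alpha> j = real j * pi / real n" for j
  define w where "w j = cis (2 * pi * real j / real n)" for j
  have w: "w j = cis (2 * \<alpha> j)" for j by (simp add: w_def \<alpha>_def mult_ac)
  have n: "n > 0" using k by simp
  have inj: "inj_on w {..<n}" unfolding w_def by (rule inj_on_cis_roots[OF n])
  note P = poly_pderiv_prod_linear[OF _ inj, of k, folded w_def]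
  have PP: "(\<Prod>j<n. [:- w j, 1:]) = monom 1 n - 1"
    unfolding w_def by (rule prod_roots_of_unity[OF n])
  have P1: "(\<Prod>j\<in>{..<n} - {k}. w k - w j) = of_nat n * w k ^ (n - 1)"
    using P(1) k by (simp add: PP pderiv_diff pderiv_monom poly_monom)
  have P2: "of_nat n * of_nat (n - 1) * w k ^ (n - 2)
              = 2 * (of_nat n * w k ^ (n - 1)) * (\<Sum>j\<in>{..<n} - {k}. 1 / (w k - w j))"
    using P(2) k by (simp add: PP pderiv_diff pderiv_monom poly_monom diff_diff_left numeral_2_eq_2)
  have "(\<Prod>j\<in>{..<n} - {k}. cmod (w k - w j)) = real n"
    using arg_cong[OF P1, of cmod] by (simp add: prod_norm norm_mult norm_power w)
  then have "2 ^ (n - 1) * (\<Prod>j\<in>{..<n} - {k}. \<bar>sin (\<alpha> k - \<alpha> j)\<bar>) = real n"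
    using k by (simp add: w cmod_cis_diff prod.distrib)
  then show "(\<Prod>j\<in>{..<n} - {k}. \<bar>sin (real k * pi / real n - real j * pi / real n)\<bar>)
      = real n / 2 ^ (n - 1)"
    by (simp add: \<alpha>_def field_simps)
  have w0: "w k \<noteq> 0" by (simp add: w)
  have "of_nat (n - 1) = 2 * (w k * (\<Sum>j\<in>{..<n} - {k}. 1 / (w k - w j)))"
  \<comment> \<open>For n = 1 the exponent \<open>n - 2\<close> is truncated; there both sides are
    0, the sum being empty.\<close>
  proof (cases "n = 1")
    case True
    then show ?thesis using k by (simp add: lessThan_Suc)
  next
    case False
    then have "n - 1 = Suc (n - 2)" using n by simp
    then have "w k ^ (n - 1) = w k ^ (n - 2) * w k" by simp
    then have "of_nat n * w k ^ (n - 2) * of_nat (n - 1)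
        = of_nat n * w k ^ (n - 2) * (2 * (w k * (\<Sum>j\<in>{..<n} - {k}. 1 / (w k - w j))))"
      using P2 by (simp add: mult_ac)
    then show ?thesis using w0 n by (subst (asm) mult_cancel_left) auto
  qed
  also have "w k * (\<Sum>j\<in>{..<n} - {k}. 1 / (w k - w j))
      = (\<Sum>j\<in>{..<n} - {k}. 1 / 2 - \<i> / 2 * of_real (cot (\<alpha> k - \<alpha> j)))"
    unfolding sum_distrib_left
  proof (intro sum.cong refl)
    fix j assume j: "j \<in> {..<n} - {k}"
    then have "w k - w j \<noteq> 0" using inj k by (auto dest: inj_onD)
    then have s: "sin (\<alpha> k - \<alpha> j) \<noteq> 0" unfolding w cis_diff by auto
    have "w k = cis (\<alpha> k - \<alpha> j) * cis (\<alpha> k + \<alpha> j)" by (simp add: w cis_mult)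
    moreover have "w k - w j = 2 * \<i> * of_real (sin (\<alpha> k - \<alpha> j)) * cis (\<alpha> k + \<alpha> j)"
      unfolding w by (rule cis_diff)
    ultimately have "w k * (1 / (w k - w j))
        = cis (\<alpha> k - \<alpha> j) / (2 * \<i> * of_real (sin (\<alpha> k - \<alpha> j)))"
      by simp
    also have "cis (\<alpha> k - \<alpha> j)
        = of_real (cos (\<alpha> k - \<alpha> j)) + \<i> * of_real (sin (\<alpha> k - \<alpha> j))"
      by (simp add: complex_eq_iff)
    also have "\<dots> / (2 * \<i> * of_real (sin (\<alpha> k - \<alpha> j)))
        = 1 / 2 - \<i> / 2 * of_real (cot (\<alpha> k - \<alpha> j))"
      using s by (simp add: cot_def field_simps)
    finally show "w k * (1 / (w k - w j)) = \<dots>" .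
  qed
  finally have "Im (of_nat (n - 1))
      = Im (2 * (\<Sum>j\<in>{..<n} - {k}. 1 / 2 - \<i> / 2 * of_real (cot (\<alpha> k - \<alpha> j))))"
    by (rule arg_cong)
  then have "(\<Sum>j\<in>{..<n} - {k}. cot (\<alpha> k - \<alpha> j)) = 0"
    by (simp add: sum_negf sum_divide_distrib[symmetric])
  \<comment> \<open>The diagonal term may be added because \<open>cot 0\<close> is 0 under the
    convention for division by zero.\<close>
  then have "(\<Sum>j<n. cot (\<alpha> k - \<alpha> j)) = 0"
    using k by (subst sum.remove[of _ k]) auto
  then show "(\<Sum>j<n. cot (real k * pi / real n - real j * pi / real n)) = 0"
    by (simp add: \<alpha>_def)
qed

section \<open>Energies in terms of angles\<close>

text \<open>
  Again the diagonal contributes nothing, since \<open>ln 0 = 0\<close>.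
\<close>

definition pair_energy :: "real set \<Rightarrow> real" where
  "pair_energy S = (\<Sum>s\<in>S. \<Sum>t\<in>S. ln \<bar>s - t\<bar>)"

text \<open>For \<open>a > 0\<close> and finite \<open>S\<close> this is 2 ln |f(ai)| for the monic
  f with simple root set \<open>S\<close>, because a^2 + s^2 = |ai - s|^2; the potential constraint
  thus prescribes its value.\<close>

definition point_energy :: "real \<Rightarrow> real set \<Rightarrow> real" where
  "point_energy a S = (\<Sum>s\<in>S. ln (a\<^sup>2 + s\<^sup>2))"

lemma discrete_energy_inj:
  assumes "inj_on x {1..d}"
  shows "discrete_energy d x
           = ereal (- (1 / (real d * (real d - 1))) * pair_energy (x ` {1..d}))"
proof -
  have "(\<Sum>k\<in>{1..d} - {j}. ln \<bar>x j - x k\<bar>) = (\<Sum>k\<in>{1..d}. ln \<bar>x j - x k\<bar>)" if "j \<in> {1..d}" for j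
    using that by (subst (2) sum.remove[of _ j]) auto
  then show ?thesis
    using assms by (simp add: discrete_energy_def pair_energy_def sum.reindex)
qed

lemma log_potential_eq_iff:
  assumes "a > 0" "d > 0"
  shows "log_potential (counting_prob d x) (complex_of_real a * \<i>) = v
           \<longleftrightarrow> (\<Sum>k=1..d. ln (a\<^sup>2 + (x k)\<^sup>2)) = - 2 * real d * v"
proof -
  let ?z = "complex_of_real a * \<i>"
  have nz: "?z \<noteq> complex_of_real t" for t
    using assms by (auto simp: complex_eq_iff)
  have "ln (cmod (\<Prod>k=1..d. ?z - complex_of_real (x k))) = (\<Sum>k=1..d. ln (cmod (?z - complex_of_real (x k))))"
    unfolding prod_norm[symmetric] by (subst ln_prod) (use nz in auto)
  also have "\<dots> = (\<Sum>k=1..d. ln (a\<^sup>2 + (x k)\<^sup>2) / 2)"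
    using assms by (intro sum.cong refl) (simp add: cmod_def ln_sqrt add_pos_nonneg add.commute)
  finally have "log_potential (counting_prob d x) ?z
      = - (1 / real d) * ((\<Sum>k=1..d. ln (a\<^sup>2 + (x k)\<^sup>2)) / 2)"
    using log_potential_counting_prob[of d ?z x] assms nz by (simp add: sum_divide_distrib)
  then show ?thesis using assms by (auto simp: field_simps)
qed

lemma log_potential_eq_iff_inj:
  assumes "a > 0" "d > 0" "inj_on x {1..d}"
  shows "log_potential (counting_prob d x) (complex_of_real a * \<i>) = v
           \<longleftrightarrow> point_energy a (x ` {1..d}) = - 2 * real d * v"
  using assms by (simp add: log_potential_eq_iff point_energy_def sum.reindex)

text \<open>The identities 1 + tan^2 = 1 / cos^2 and tan s - tan t = sin (s - t) / (cos s * cos t)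
  do the work; each cosine enters 2 (d - 1) ordered pairs.\<close>

lemma
  assumes a: "a > 0" and cos: "\<And>k. k < d \<Longrightarrow> cos (\<theta> k) \<noteq> 0"
    and inj: "inj_on (\<lambda>k. a * tan (\<theta> k)) {..<d}"
  defines "S \<equiv> (\<lambda>k. a * tan (\<theta> k)) ` {..<d}"
  shows point_energy_tan: "point_energy a S = 2 * real d * ln a - 2 * (\<Sum>k<d. ln \<bar>cos (\<theta> k)\<bar>)"
    and pair_energy_tan: "pair_energy S = real d * (real d - 1) * ln a + sin_energy d \<theta>
           - 2 * (real d - 1) * (\<Sum>k<d. ln \<bar>cos (\<theta> k)\<bar>)"
proof -
  define c where "c k = ln \<bar>cos (\<theta> k)\<bar>" for k
  have "ln (a\<^sup>2 + (a * tan (\<theta> k))\<^sup>2) = 2 * ln a - 2 * c k" if "k < d" for k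
  proof -
    have "a\<^sup>2 + (a * tan (\<theta> k))\<^sup>2 = (a / \<bar>cos (\<theta> k)\<bar>)\<^sup>2"
      using cos[OF that] sin_cos_squared_add2[of "\<theta> k"]
      by (simp add: tan_def power_mult_distrib power_divide field_simps) (simp flip: distrib_left)
    then show ?thesis
      using a cos[OF that] by (simp add: ln_realpow ln_div c_def)
  qed
  then show "point_energy a S = 2 * real d * ln a - 2 * (\<Sum>k<d. ln \<bar>cos (\<theta> k)\<bar>)"
    unfolding point_energy_def S_def
    by (simp add: sum.reindex[OF inj] sum_subtractf sum_distrib_left c_def)
  \<comment> \<open>On the diagonal the left side is ln 0 = 0, so the last term removes what the
    generic formula leaves there, namely \<open>ln a - 2 * c k\<close>.\<close>
  have "ln \<bar>a * tan (\<theta> k) - a * tan (\<theta> j)\<bar>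
      = ln a + ln \<bar>sin (\<theta> k - \<theta> j)\<bar> - c k - c j - (if j = k then ln a - 2 * c k else 0)"
    if "k < d" "j < d" for k j
  proof (cases "j = k")
    case False
    have "a * tan (\<theta> k) - a * tan (\<theta> j) = a * sin (\<theta> k - \<theta> j) / (cos (\<theta> k) * cos (\<theta> j))"
      using cos that by (simp add: tan_def sin_diff field_simps)
    moreover have "a * tan (\<theta> k) \<noteq> a * tan (\<theta> j)"
      using False inj that by (auto dest: inj_onD)
    ultimately have "sin (\<theta> k - \<theta> j) \<noteq> 0"
      "\<bar>a * tan (\<theta> k) - a * tan (\<theta> j)\<bar>
         = a * \<bar>sin (\<theta> k - \<theta> j)\<bar> / (\<bar>cos (\<theta> k)\<bar> * \<bar>cos (\<theta> j)\<bar>)"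
      using a by (auto simp: abs_mult)
    then show ?thesis
      using a cos that False by (simp add: ln_div ln_mult c_def)
  qed auto
  then have "pair_energy S = (\<Sum>k<d. \<Sum>j<d. ln a + ln \<bar>sin (\<theta> k - \<theta> j)\<bar> - c k - c j
      - (if j = k then ln a - 2 * c k else 0))"
    unfolding pair_energy_def S_def by (simp add: sum.reindex[OF inj])
  also have "\<dots> = real d * (real d - 1) * ln a + sin_energy d \<theta> - 2 * (real d - 1) * (\<Sum>k<d. c k)"
    by (simp add: sum_subtractf sum.distrib sin_energy_def algebra_simps sum_distrib_left)
  finally show "pair_energy S = real d * (real d - 1) * ln a + sin_energy d \<theta>
           - 2 * (real d - 1) * (\<Sum>k<d. ln \<bar>cos (\<theta> k)\<bar>)"
    by (simp add: c_def)
qed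

lemma ordered_angles_tan:
  assumes "ordered_angles d \<theta>" "a > 0"
  shows "k < d \<Longrightarrow> cos (\<theta> k) > 0" "inj_on (\<lambda>k. a * tan (\<theta> k)) {..<d}"
proof -
  show "cos (\<theta> k) > 0" if "k < d"
    using assms(1) that by (intro cos_gt_zero_pi) (auto simp: ordered_angles_def abs_less_iff)
  show "inj_on (\<lambda>k. a * tan (\<theta> k)) {..<d}"
  proof (rule inj_onI)
    fix j k assume *: "j \<in> {..<d}" "k \<in> {..<d}" "a * tan (\<theta> j) = a * tan (\<theta> k)"
    have "\<bar>\<theta> j\<bar> < pi / 2" "\<bar>\<theta> k\<bar> < pi / 2" using * assms by (auto simp: ordered_angles_def)
    then have "arctan (tan (\<theta> j)) = \<theta> j" "arctan (tan (\<theta> k)) = \<theta> k"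
      by (auto intro!: arctan_tan simp: abs_less_iff)
    moreover have "tan (\<theta> j) = tan (\<theta> k)" using * \<open>a > 0\<close> by simp
    ultimately have "\<theta> j = \<theta> k" by metis
    then show "j = k"
      using * assms by (auto simp: ordered_angles_def dest: strict_mono_on_eqD)
  qed
qed

lemma obtain_strict_mono_on:
  fixes S :: "real set"
  assumes "finite S"
  obtains r where "strict_mono_on {..<card S} r" "S = r ` {..<card S}"
proof
  have len: "length (sorted_list_of_set S) = card S" using assms by simp
  show "strict_mono_on {..<card S} (\<lambda>k. sorted_list_of_set S ! k)"
    using sorted_list_of_set.strict_sorted_key_list_of_set[of S]
    by (auto simp: strict_mono_on_def sorted_wrt_iff_nth_less len)
  show "S = (\<lambda>k. sorted_list_of_set S ! k) ` {..<card S}"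
    using set_conv_nth[of "sorted_list_of_set S"] assms unfolding len by auto
qed

lemma ordered_angles_arctan:
  assumes "strict_mono_on {..<d} r" "a > 0"
  shows "ordered_angles d (\<lambda>k. arctan (r k / a))"
    and "(\<lambda>k. a * tan (arctan (r k / a))) = r"
proof -
  have "\<bar>arctan y\<bar> < pi / 2" for y
    using arctan_bounded[of y] by linarith
  then show "ordered_angles d (\<lambda>k. arctan (r k / a))"
    using assms
    by (simp add: ordered_angles_def strict_mono_on_def arctan_less_iff divide_strict_right_mono)
  show "(\<lambda>k. a * tan (arctan (r k / a))) = r"
    using assms(2) by (simp add: tan_arctan)
qed

lemma obtain_ordered_angles:
  fixes S :: "real set"
  assumes "finite S" "a > 0"
  obtains \<theta> where "ordered_angles (card S) \<theta>" "S = (\<lambda>k. a * tan (\<theta> k)) ` {..<card S}"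
proof -
  obtain r where r: "strict_mono_on {..<card S} r" "S = r ` {..<card S}"
    using obtain_strict_mono_on[OF assms(1)] by blast
  show ?thesis
    using that[OF ordered_angles_arctan(1)[OF r(1) assms(2)]] r(2)
    unfolding ordered_angles_arctan(2)[OF r(1) assms(2)] .
qed

section \<open>The universal bound and its equality case\<close>

text \<open>Spacing pi / d, centred at 0 so that all \<open>d\<close> angles lie strictly inside
  (-pi/2, pi/2).\<close>

definition equi_angle :: "nat \<Rightarrow> nat \<Rightarrow> real" where
  "equi_angle d k = real k * pi / real d - (real d - 1) * pi / (2 * real d)"

lemma equi_angle_diff:
  "equi_angle d k - equi_angle d j = real k * pi / real d - real j * pi / real d"
  by (simp add: equi_angle_def)

lemma ordered_angles_equi: "ordered_angles d (equi_angle d)"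
proof -
  have "\<bar>equi_angle d k\<bar> < pi / 2" if "k < d" for k
  proof -
    have "equi_angle d k = (2 * real k - (real d - 1)) * pi / (2 * real d)"
      using that by (simp add: equi_angle_def field_simps)
    also have "\<bar>\<dots>\<bar> = \<bar>2 * real k - (real d - 1)\<bar> * (pi / (2 * real d))"
      by (simp add: abs_mult)
    also have "\<dots> < real d * (pi / (2 * real d))"
      using that by (intro mult_strict_right_mono) auto
    finally show ?thesis using that by simp
  qed
  then show ?thesis
    by (auto simp: ordered_angles_def strict_mono_on_def equi_angle_def divide_strict_right_mono)
qed

text \<open>Only differences matter, so the product formula for sines evaluates each inner sum to ln
  (d / 2^(d-1)), whatever the rotation.\<close>

lemma sin_energy_spacing:
  assumes d: "d > 0" and "\<And>j k. j < d \<Longrightarrow> k < d \<Longrightarrow> \<theta> k - \<theta> j = real k * pi / real d - real j * pi / real d"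
  shows "sin_energy d \<theta> = real d * (ln (real d) - (real d - 1) * ln 2)"
proof -
  have "(\<Sum>j<d. ln \<bar>sin (\<theta> k - \<theta> j)\<bar>) = ln (real d) - (real d - 1) * ln 2" if k: "k < d" for k
  proof -
    let ?s = "\<lambda>j. \<bar>sin (real k * pi / real d - real j * pi / real d)\<bar>"
    have "prod ?s ({..<d} - {k}) \<noteq> 0"
      using d by (simp only: abs_prod_sin_diff[OF k]) simp
    then have nz: "?s j \<noteq> 0" if "j \<in> {..<d} - {k}" for j
      using that by (simp add: prod_zero_iff)
    have "(\<Sum>j<d. ln \<bar>sin (\<theta> k - \<theta> j)\<bar>) = (\<Sum>j<d. ln (?s j))"
      using assms k by simp
    also have "\<dots> = (\<Sum>j\<in>{..<d} - {k}. ln (?s j))"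
      using k by (subst sum.remove[of _ k]) auto
    also have "\<dots> = ln (prod ?s ({..<d} - {k}))"
      using nz by (subst ln_prod) auto
    also have "\<dots> = ln (real d) - (real d - 1) * ln 2"
      unfolding abs_prod_sin_diff[OF k] using d by (simp add: ln_div ln_realpow of_nat_diff)
    finally show ?thesis .
  qed
  then show ?thesis by (simp add: sin_energy_def)
qed

text \<open>At s = 0 the critical condition is the vanishing of the cotangent sums, which equal
  spacing satisfies; the equality case leaves a free rotation.\<close>

lemma
  assumes \<theta>: "ordered_angles d \<theta>" and d: "d > 0"
  shows sin_energy_le: "sin_energy d \<theta> \<le> real d * (ln (real d) - (real d - 1) * ln 2)"
    and sin_energy_eqD: "sin_energy d \<theta> = real d * (ln (real d) - (real d - 1) * ln 2)
           \<Longrightarrow> k < d \<Longrightarrow> \<theta> k = \<theta> 0 + real k * pi / real d"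
proof -
  note * = critical_angles_maximal[OF \<theta> ordered_angles_equi, of 0, unfolded equi_angle_diff]
  have e: "sin_energy d (equi_angle d) = real d * (ln (real d) - (real d - 1) * ln 2)"
    by (rule sin_energy_spacing[OF d]) (rule equi_angle_diff)
  show "sin_energy d \<theta> \<le> real d * (ln (real d) - (real d - 1) * ln 2)"
    using *(1) sum_cot_diff e by simp
  show "\<theta> k = \<theta> 0 + real k * pi / real d"
    if "sin_energy d \<theta> = real d * (ln (real d) - (real d - 1) * ln 2)" "k < d"
    using *(2)[of 0 k] sum_cot_diff e that by simp
qed

text \<open>In the angles of \<open>S\<close> the constraint fixes the sum of ln cos, so only
  \<open>sin_energy\<close> varies and its maximum yields the bound. The positivity of the cosines
  is recorded so that the phase \<open>t\<close> can later be recovered from their product.\<close>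

lemma pair_energy_le:
  assumes "finite S" "card S = d" "d > 0" "a > 0" "point_energy a S = - 2 * real d * v"
  shows "pair_energy S \<le> real d * ln (real d) - real d * (real d - 1) * (2 * v + ln (2 * a))"
    and "pair_energy S = real d * ln (real d) - real d * (real d - 1) * (2 * v + ln (2 * a))
          \<Longrightarrow> \<exists>t. S = (\<lambda>k. a * tan (t + real k * pi / real d)) ` {..<d}
                 \<and> (\<forall>k<d. cos (t + real k * pi / real d) > 0)"
proof -
  obtain \<theta> where \<theta>: "ordered_angles d \<theta>" "S = (\<lambda>k. a * tan (\<theta> k)) ` {..<d}"
    using obtain_ordered_angles[of S a] assms by metis
  note o = ordered_angles_tan[OF \<theta>(1) \<open>a > 0\<close>]
  have nz: "cos (\<theta> k) \<noteq> 0" if "k < d" for k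
    using o(1)[OF that] by (rule less_imp_neq[symmetric])
  have "(\<Sum>k<d. ln \<bar>cos (\<theta> k)\<bar>) = real d * (ln a + v)"
    using point_energy_tan[OF \<open>a > 0\<close> nz o(2)] assms(5) unfolding \<theta>(2)
    by (simp add: algebra_simps)
  moreover have "pair_energy S = real d * (real d - 1) * ln a + sin_energy d \<theta>
           - 2 * (real d - 1) * (\<Sum>k<d. ln \<bar>cos (\<theta> k)\<bar>)"
    unfolding \<theta>(2) by (rule pair_energy_tan[OF \<open>a > 0\<close> nz o(2)])
  ultimately have E: "pair_energy S = sin_energy d \<theta> - real d * (real d - 1) * (ln a + 2 * v)"
    by (simp add: algebra_simps)
  have b: "real d * ln (real d) - real d * (real d - 1) * (2 * v + ln (2 * a))
      = real d * (ln (real d) - (real d - 1) * ln 2) - real d * (real d - 1) * (ln a + 2 * v)"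
    using \<open>a > 0\<close> by (simp add: ln_mult algebra_simps)
  show "pair_energy S \<le> real d * ln (real d) - real d * (real d - 1) * (2 * v + ln (2 * a))"
    unfolding b E using sin_energy_le[OF \<theta>(1) \<open>d > 0\<close>] by simp
  assume "pair_energy S = real d * ln (real d) - real d * (real d - 1) * (2 * v + ln (2 * a))"
  then have "sin_energy d \<theta> = real d * (ln (real d) - (real d - 1) * ln 2)"
    using E b by simp
  note spaced = sin_energy_eqD[OF \<theta>(1) \<open>d > 0\<close> this]
  have "S = (\<lambda>k. a * tan (\<theta> 0 + real k * pi / real d)) ` {..<d}"
    unfolding \<theta>(2) by (rule image_cong[OF refl], subst spaced) auto
  moreover have "cos (\<theta> 0 + real k * pi / real d) > 0" if "k < d" for k
    using o(1)[OF that] unfolding spaced[OF that] .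
  ultimately show "\<exists>t. S = (\<lambda>k. a * tan (t + real k * pi / real d)) ` {..<d}
                 \<and> (\<forall>k<d. cos (t + real k * pi / real d) > 0)"
    by blast
qed

section \<open>Equally spaced angles\<close>

text \<open>The phase \<open>t\<close> is unrestricted, so the angles may leave (-pi/2, pi/2); only
  their classes modulo pi matter.\<close>

definition spaced_tans :: "real \<Rightarrow> nat \<Rightarrow> real \<Rightarrow> real set" where
  "spaced_tans a d t = (\<lambda>k. a * tan (t + real k * pi / real d)) ` {..<d}"

text \<open>Reducing the index modulo \<open>d\<close> changes the angle by a multiple of pi. Over
  all integers, shifts and reflections become mere reindexings.\<close>

lemma spaced_tans_range:
  assumes "d > 0"
  shows "spaced_tans a d t = range (\<lambda>k::int. a * tan (t + of_int k * pi / real d))"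
proof (intro subset_antisym subsetI)
  fix y assume "y \<in> spaced_tans a d t"
  then obtain k where "y = a * tan (t + real_of_int (int k) * pi / real d)"
    by (auto simp: spaced_tans_def)
  then show "y \<in> range (\<lambda>k::int. a * tan (t + of_int k * pi / real d))" by blast
next
  fix y assume "y \<in> range (\<lambda>k::int. a * tan (t + of_int k * pi / real d))"
  then obtain k :: int where y: "y = a * tan (t + of_int k * pi / real d)" by blast
  define j where "j = nat (k mod int d)"
  have j: "j < d" using assms by (simp add: j_def nat_less_iff)
  have "int j = k mod int d" using assms by (simp add: j_def)
  then have "k = int d * (k div int d) + int j" by simp
  then have "real_of_int k = real d * of_int (k div int d) + real j"
    by (metis of_int_add of_int_mult of_int_of_nat_eq)
  then have "t + of_int k * pi / real d = (t + real j * pi / real d) + of_int (k div int d) * pi"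
    using assms by (simp add: field_simps)
  then have "y = a * tan (t + real j * pi / real d)" unfolding y by (simp only: tan_periodic_int)
  then show "y \<in> spaced_tans a d t" using j by (auto simp: spaced_tans_def)
qed

lemma spaced_tans_shift:
  assumes "d > 0"
  shows "spaced_tans a d (t + of_int n * pi / real d) = spaced_tans a d t"
proof -
  have "range (\<lambda>k::int. a * tan (t + of_int n * pi / real d + of_int k * pi / real d))
      = (\<lambda>k::int. a * tan (t + of_int k * pi / real d)) ` range (\<lambda>k. n + k)"
    unfolding image_image by (simp add: algebra_simps add_divide_distrib)
  also have "range (\<lambda>k. n + k) = UNIV" by (rule surj_plus)
  finally show ?thesis by (simp only: spaced_tans_range[OF assms])
qed

lemma spaced_tans_minus:
  assumes "d > 0"
  shows "spaced_tans a d (- t) = uminus ` spaced_tans a d t"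
proof -
  have "uminus ` range (\<lambda>k::int. a * tan (t + of_int k * pi / real d))
      = range (\<lambda>k::int. a * tan (- t - of_int k * pi / real d))"
    unfolding image_image
    using tan_minus[of "t + of_int k * pi / real d" for k]
    by (intro image_cong refl) simp
  also have "\<dots> = (\<lambda>k::int. a * tan (- t + of_int k * pi / real d)) ` range uminus"
    unfolding image_image by simp
  also have "range uminus = (UNIV :: int set)" by (rule surj_uminus)
  finally show ?thesis by (simp only: spaced_tans_range[OF assms])
qed

lemma abs_prod_cos_shift:
  assumes "d > 0"
  shows "(\<Prod>k<d. \<bar>cos (t + real k * pi / real d)\<bar>) = \<bar>sin (real d * t + real d * pi / 2)\<bar> / 2 ^ (d - 1)"
proof -
  have "cos (t + real k * pi / real d) = sin (t + pi / 2 + real k * pi / real d)" for k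
    using sin_add[of "t + real k * pi / real d" "pi / 2"] by (simp add: ac_simps)
  then show ?thesis
    using abs_prod_sin_shift[OF assms, of "t + pi / 2"] by (simp add: distrib_left)
qed

text \<open>By \<open>abs_prod_cos_shift\<close>, \<open>p > 0\<close> keeps every angle off the
  poles of tan, and \<open>p\<close> is the only feature of the phase that enters the
  energies.\<close>

lemma spaced_tans_properties:
  assumes d: "d > 0" and a: "a > 0" and p: "\<bar>sin (real d * t + real d * pi / 2)\<bar> = p" "p > 0"
  shows "card (spaced_tans a d t) = d"
    and "point_energy a (spaced_tans a d t) = 2 * real d * ln a - 2 * (ln p - (real d - 1) * ln 2)"
    and "pair_energy (spaced_tans a d t)
           = real d * (real d - 1) * ln a + real d * (ln (real d) - (real d - 1) * ln 2)
             - 2 * (real d - 1) * (ln p - (real d - 1) * ln 2)"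
proof -
  define \<theta> where "\<theta> k = t + real k * pi / real d" for k
  have S: "spaced_tans a d t = (\<lambda>k. a * tan (\<theta> k)) ` {..<d}"
    by (simp add: spaced_tans_def \<theta>_def)
  have prod: "(\<Prod>k<d. \<bar>cos (\<theta> k)\<bar>) = p / 2 ^ (d - 1)"
    unfolding \<theta>_def abs_prod_cos_shift[OF d] p ..
  then have "(\<Prod>k<d. \<bar>cos (\<theta> k)\<bar>) \<noteq> 0" using p by simp
  then have nz: "cos (\<theta> k) \<noteq> 0" if "k < d" for k using that by simp
  have inj: "inj_on (\<lambda>k. a * tan (\<theta> k)) {..<d}"
  \<comment> \<open>Equal tangents would make the sine of a difference of two spaced angles vanish,
    against the nonzero product in \<open>abs_prod_sin_diff\<close>.\<close>
  proof (rule inj_onI, rule ccontr)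
    fix j k assume *: "j \<in> {..<d}" "k \<in> {..<d}" "a * tan (\<theta> j) = a * tan (\<theta> k)" "j \<noteq> k"
    have "sin (\<theta> k - \<theta> j) = (tan (\<theta> k) - tan (\<theta> j)) * (cos (\<theta> k) * cos (\<theta> j))"
      using nz * by (simp add: tan_def sin_diff field_simps)
    then have "sin (\<theta> k - \<theta> j) = 0" using * a by simp
    then have "sin (real k * pi / real d - real j * pi / real d) = 0" by (simp add: \<theta>_def)
    then have "(\<Prod>j\<in>{..<d} - {k}. \<bar>sin (real k * pi / real d - real j * pi / real d)\<bar>) = 0"
      using * by (intro prod_zero) auto
    then show False using abs_prod_sin_diff[of k d] * d by (simp only: lessThan_iff) simp
  qed
  show "card (spaced_tans a d t) = d" unfolding S by (simp add: card_image[OF inj])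
  have "(\<Sum>k<d. ln \<bar>cos (\<theta> k)\<bar>) = ln (\<Prod>k<d. \<bar>cos (\<theta> k)\<bar>)"
    using nz by (subst ln_prod) auto
  also have "\<dots> = ln p - (real d - 1) * ln 2"
    unfolding prod using p d by (simp add: ln_div ln_realpow of_nat_diff)
  finally have c: "(\<Sum>k<d. ln \<bar>cos (\<theta> k)\<bar>) = \<dots>" .
  have e: "sin_energy d \<theta> = real d * (ln (real d) - (real d - 1) * ln 2)"
    by (rule sin_energy_spacing[OF d]) (simp add: \<theta>_def)
  show "point_energy a (spaced_tans a d t) = 2 * real d * ln a - 2 * (ln p - (real d - 1) * ln 2)"
    unfolding S using point_energy_tan[OF a nz inj] c by simp
  show "pair_energy (spaced_tans a d t)
           = real d * (real d - 1) * ln a + real d * (ln (real d) - (real d - 1) * ln 2)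
             - 2 * (real d - 1) * (ln p - (real d - 1) * ln 2)"
    unfolding S using pair_energy_tan[OF a nz inj] c e by simp
qed

text \<open>The product sin (s + t) * sin (s - t) equals sin^2 s - sin^2 t, which is 0 here.\<close>

lemma abs_sin_eqD:
  fixes s t :: real
  assumes "\<bar>sin s\<bar> = \<bar>sin t\<bar>"
  shows "\<exists>n::int. s = t + of_int n * pi \<or> s = - t + of_int n * pi"
proof -
  have "sin (s + t) * sin (s - t) = (sin s)\<^sup>2 * (cos t)\<^sup>2 - (cos s)\<^sup>2 * (sin t)\<^sup>2"
    by (simp add: sin_add sin_diff power2_eq_square algebra_simps)
  also have "\<dots> = (sin s)\<^sup>2 - (sin t)\<^sup>2"
    by (simp add: cos_squared_eq algebra_simps)
  also have "\<dots> = 0" using assms by (metis abs_eq_iff power2_minus right_minus_eq)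
  finally have "sin (s - t) = 0 \<or> sin (s + t) = 0" by auto
  then show ?thesis unfolding sin_zero_iff_int2
    by (metis add.commute add_diff_cancel_left' diff_add_cancel uminus_add_conv_diff)
qed

lemma spaced_tans_cases:
  assumes d: "d > 0"
    and "\<bar>sin (real d * t + real d * pi / 2)\<bar> = \<bar>sin (real d * u + real d * pi / 2)\<bar>"
  shows "spaced_tans a d t = spaced_tans a d u \<or> spaced_tans a d t = uminus ` spaced_tans a d u"
proof -
  obtain n :: int where n: "real d * t + real d * pi / 2 = real d * u + real d * pi / 2 + of_int n * pi
      \<or> real d * t + real d * pi / 2 = - (real d * u + real d * pi / 2) + of_int n * pi"
    using abs_sin_eqD[OF assms(2)] by blast
  \<comment> \<open>In the reflected case the two terms \<open>real d * pi / 2\<close> combine to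
    \<open>real d * pi\<close>, which shifts the integer by \<open>d\<close>.\<close>
  then have "t = u + of_int n * pi / real d \<or> t = - u + of_int (n - int d) * pi / real d"
    using d by (auto simp: field_simps)
  then show ?thesis
    using spaced_tans_shift[OF d] spaced_tans_minus[OF d] by metis
qed

text \<open>A shift by \<open>n\<close> quarter periods exchanges sine and cosine for odd
  \<open>n\<close>: hence the split by parity into arccos and arcsin in
  \<open>tan_gamma\<close>.\<close>

lemma abs_sin_add_half_pi:
  "\<bar>sin (t + real n * pi / 2)\<bar> = (if odd n then \<bar>cos t\<bar> else \<bar>sin t\<bar>)"
proof -
  have *: "\<bar>sin (s + real k * pi)\<bar> = \<bar>sin s\<bar>" for s k
    by (simp add: sin_add abs_mult power_abs cos_npi sin_npi)
  show ?thesis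
  proof (cases "odd n")
    case True
    then obtain k where "n = 2 * k + 1" by (auto elim: oddE)
    then have "t + real n * pi / 2 = (t + pi / 2) + real k * pi" by (simp add: field_simps)
    then have "\<bar>sin (t + real n * pi / 2)\<bar> = \<bar>sin (t + pi / 2)\<bar>" using * by metis
    then show ?thesis using True by (simp add: sin_add)
  next
    case False
    then obtain k where "n = 2 * k" by (auto elim: evenE)
    then have "t + real n * pi / 2 = t + real k * pi" by simp
    then show ?thesis using *[of t k] False by simp
  qed
qed

text \<open>The parameter inside \<open>tan_gamma\<close> collapses to 2^(d-1) * a^d * e^(dv), as a
  comparison of logarithms shows. The bound on \<open>v\<close> says precisely that it is at most 1,
  so that arccos and arcsin are genuine inverses at it.\<close>

lemma abs_sin_tan_gamma:
  assumes a: "a > 0" and d: "d \<ge> 2" and v: "v \<le> (1 / real d - 1) * ln 2 - ln a"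
  defines "p \<equiv> exp ((real d - 1) * ln 2 + real d * ln a + real d * v)"
  shows "\<bar>sin (real d * tan_gamma a d v + real d * pi / 2)\<bar> = p"
proof -
  define m where "m = exp (- v * real d)"
  define D where "D = m ^ (2 * d - 2) * real d ^ d / (2 * a) ^ (d * (d - 1))"
  define q where "q = a powr (real d / 2) * 2 powr (real d / 2 - 1)
                * real d powr (real d / (2 * real d - 2)) * D powr (- 1 / (2 * real d - 2))"
  have m0: "m > 0" by (simp add: m_def algebra_simps)
  have D0: "D > 0" using m0 a d by (simp add: D_def)
  have q0: "q > 0" using a d D0 by (simp add: q_def)
  have d': "2 * real d - 2 > 0" "real (d - 1) = real d - 1" "real (2 * d - 2) = 2 * real d - 2"
    using d by (auto simp: of_nat_diff)
  have lnD: "ln D = - (2 * real d - 2) * v * real d + real d * ln (real d) - real d * (real d - 1) * (ln 2 + ln a)"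
    using m0 a d d' by (simp add: D_def ln_div ln_mult ln_realpow) (simp add: m_def algebra_simps)
  have "ln q = real d / 2 * ln a + (real d / 2 - 1) * ln 2 + real d / (2 * real d - 2) * ln (real d)
        - 1 / (2 * real d - 2) * ln D"
    using a d D0 by (simp add: q_def ln_mult ln_powr)
  also have "1 / (2 * real d - 2) * ln D
      = - v * real d + real d / (2 * real d - 2) * ln (real d) - real d / 2 * (ln 2 + ln a)"
    unfolding lnD using d'(1) by (simp add: divide_simps) (simp add: algebra_simps)
  finally have "ln q = (real d - 1) * ln 2 + real d * ln a + real d * v"
    by (simp add: field_simps)
  then have qp: "q = p" unfolding p_def using q0 by (metis exp_ln)
  have "real d * v \<le> real d * ((1 / real d - 1) * ln 2 - ln a)"
    using v d by (intro mult_left_mono) auto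
  then have "(real d - 1) * ln 2 + real d * ln a + real d * v \<le> 0"
    using d by (simp add: algebra_simps)
  then have q1: "q \<le> 1" unfolding qp p_def by simp
  have "tan_gamma a d v = (if odd d then arccos q / real d else arcsin q / real d)"
    unfolding tan_gamma_def Let_def q_def D_def m_def ..
  then have "real d * tan_gamma a d v = (if odd d then arccos q else arcsin q)"
    using d by simp
  then show ?thesis
    unfolding abs_sin_add_half_pi qp[symmetric] using q0 q1 by simp
qed

text \<open>The equality case of \<open>pair_energy_le\<close> makes \<open>S\<close> equally
  spaced, and the constraint then determines |sin| of the phase, which leaves one set and its mirror
  image. Conversely both sets have the right phase.\<close>

lemma pair_energy_max_iff:
  assumes a: "a > 0" and d: "d \<ge> 2" and v: "v \<le> (1 / real d - 1) * ln 2 - ln a"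
  defines "T \<equiv> spaced_tans a d (tan_gamma a d v)"
  shows "card S = d \<and> point_energy a S = - 2 * real d * v
      \<and> pair_energy S = real d * ln (real d) - real d * (real d - 1) * (2 * v + ln (2 * a))
    \<longleftrightarrow> S = T \<or> S = uminus ` T" (is "?L \<longleftrightarrow> ?R")
proof
  define p where "p = exp ((real d - 1) * ln 2 + real d * ln a + real d * v)"
  have d0: "d > 0" using d by simp
  have g: "\<bar>sin (real d * tan_gamma a d v + real d * pi / 2)\<bar> = p"
    unfolding p_def by (rule abs_sin_tan_gamma) fact+
  have p: "p > 0" "ln p = (real d - 1) * ln 2 + real d * ln a + real d * v"
    by (auto simp: p_def)
  {
    assume L: ?L
    then have fin: "finite S" using d by (intro card_ge_0_finite) simp
    obtain t where t: "S = spaced_tans a d t" "\<And>k. k < d \<Longrightarrow> cos (t + real k * pi / real d) > 0"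
      using pair_energy_le(2)[of S d a v] L fin d0 a unfolding spaced_tans_def by blast
    define q where "q = \<bar>sin (real d * t + real d * pi / 2)\<bar>"
    have "(\<Prod>k<d. \<bar>cos (t + real k * pi / real d)\<bar>) \<noteq> 0"
      using t(2) by (simp add: less_imp_neq[symmetric])
    then have "q > 0" unfolding abs_prod_cos_shift[OF d0] q_def by simp
    then have "- 2 * real d * v = 2 * real d * ln a - 2 * (ln q - (real d - 1) * ln 2)"
      using spaced_tans_properties(2)[OF d0 a q_def[symmetric]] L t(1) by simp
    then have "ln q = ln p" unfolding p by (simp add: algebra_simps)
    then have "q = p" using \<open>q > 0\<close> p(1) by simp
    then show ?R
      unfolding T_def t(1) by (intro spaced_tans_cases[OF d0]) (simp add: g q_def)
  next
    assume R: ?R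
    have "\<bar>sin (real d * (- tan_gamma a d v) + real d * pi / 2)\<bar> = p"
      using g unfolding abs_sin_add_half_pi by (simp split: if_splits)
    with R obtain t where t: "S = spaced_tans a d t" "\<bar>sin (real d * t + real d * pi / 2)\<bar> = p"
      using g unfolding T_def spaced_tans_minus[OF d0, symmetric] by blast
    show ?L
      using spaced_tans_properties[OF d0 a t(2) p(1)] a
      unfolding t(1) p(2) by (simp add: ln_mult algebra_simps)
  }
qed

section \<open>The polynomials \<open>G\<close>\<close>

lemma G_coeff_0 [simp]: "G_coeff l d 0 = 1"
  by (simp add: G_coeff_def)

lemma G_poly_altdef:
  "G_poly d a l = (\<Sum>k\<le>d div 2. monom ((-1) ^ k * a ^ (2 * k) * G_coeff l d k) (d - 2 * k))"
  by (simp add: G_poly_def atMost_atLeast0 sum.atLeast_Suc_atMost)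

lemma coeff_G_poly:
  "coeff (G_poly d a l) n = (if n \<le> d \<and> even (d - n)
     then (-1) ^ ((d - n) div 2) * a ^ (d - n) * G_coeff l d ((d - n) div 2) else 0)"
proof -
  let ?g = "\<lambda>k. (-1) ^ k * a ^ (2 * k) * G_coeff l d k"
  have "coeff (G_poly d a l) n = (\<Sum>k\<le>d div 2. if d - 2 * k = n then ?g k else 0)"
    by (simp add: G_poly_altdef coeff_sum)
  also have "\<dots> = (\<Sum>k\<le>d div 2. if k = (d - n) div 2 then (if n \<le> d \<and> even (d - n) then ?g k else 0) else 0)"
  proof (intro sum.cong refl)
    fix k assume "k \<in> {..d div 2}"
    then have "d - 2 * k = n \<longleftrightarrow> k = (d - n) div 2 \<and> n \<le> d \<and> even (d - n)"
      by auto
    then show "(if d - 2 * k = n then ?g k else 0)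
      = (if k = (d - n) div 2 then (if n \<le> d \<and> even (d - n) then ?g k else 0) else 0)"
      by simp
  qed
  also have "\<dots> = (if n \<le> d \<and> even (d - n) then ?g ((d - n) div 2) else 0)"
    by (simp add: div_le_mono)
  finally show ?thesis by auto
qed

lemma degree_G_poly: "degree (G_poly d a l) = d"
  and lead_coeff_G_poly: "lead_coeff (G_poly d a l) = 1"
proof -
  have "degree (G_poly d a l) \<le> d" by (rule degree_le) (simp add: coeff_G_poly)
  moreover have c: "coeff (G_poly d a l) d = 1" by (simp add: coeff_G_poly)
  then have "degree (G_poly d a l) \<ge> d" by (intro le_degree) simp
  ultimately show "degree (G_poly d a l) = d" by simp
  then show "lead_coeff (G_poly d a l) = 1" using c by simp
qed

lemma poly_G_poly_minus: "poly (G_poly d a l) (- x) = (-1) ^ d * poly (G_poly d a l) x"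
proof -
  have "(- x) ^ (d - 2 * k) = (-1) ^ d * x ^ (d - 2 * k)" if "k \<le> d div 2" for k
  proof -
    have "(-1) ^ d = (-1 :: real) ^ (d - 2 * k)"
      using that by (simp add: minus_one_power_iff)
    then show ?thesis by (metis power_minus)
  qed
  then show ?thesis
    by (simp add: G_poly_altdef poly_sum poly_monom sum_distrib_left mult_ac)
qed

text \<open>The shift in \<open>l\<close> is chosen so that \<open>l - 2 * real d\<close> is
  unchanged; the denominators then agree and binomial absorption does the rest.\<close>

lemma pderiv_G_poly:
  "pderiv (G_poly (Suc d) a (l + 2)) = smult (real (Suc d)) (G_poly d a l)"
proof (rule poly_eqI)
  fix n
  show "coeff (pderiv (G_poly (Suc d) a (l + 2))) n = coeff (smult (real (Suc d)) (G_poly d a l)) n"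
  proof (cases "n \<le> d \<and> even (d - n)")
    case True
    define k where "k = (d - n) div 2"
    have k: "d - n = 2 * k" using True unfolding k_def by (metis dvd_mult_div_cancel)
    have "Suc d - 2 * k = Suc n" using k True by linarith
    then have "Suc n * (Suc d choose (2 * k)) = Suc d * (d choose (2 * k))"
      using binomial_absorb_comp[of "Suc d" "2 * k"] by simp
    then have "real (Suc n) * real (Suc d choose (2 * k)) = real (Suc d) * real (d choose (2 * k))"
      by (metis of_nat_mult)
    moreover have "l + 2 - 2 * real (Suc d) = l - 2 * real d" by simp
    ultimately have "real (Suc n) * G_coeff (l + 2) (Suc d) k = real (Suc d) * G_coeff l d k"
      by (simp only: G_coeff_def times_divide_eq_right mult.assoc[symmetric])
    then show ?thesis
      using True k by (simp add: coeff_pderiv coeff_G_poly k del: of_nat_Suc)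
  qed (auto simp: coeff_pderiv coeff_G_poly)
qed

lemma G_coeff_Suc:
  assumes "l > 2 * real d - 2" "2 * k \<le> d"
  shows "2 * (real k + 1) * (l - 2 * real d + 2 * real k + 3) * G_coeff l d (Suc k)
           = (real d - 2 * real k) * (real d - 2 * real k - 1) * G_coeff l d k"
proof -
  have "Suc (2 * k) * (d choose Suc (2 * k)) = (d - 2 * k) * (d choose (2 * k))"
    using binomial_absorption[of "2 * k" d] binomial_absorb_comp[of d "2 * k"] by simp
  moreover have "Suc (Suc (2 * k)) * (d choose Suc (Suc (2 * k))) = (d - Suc (2 * k)) * (d choose Suc (2 * k))"
    using binomial_absorption[of "Suc (2 * k)" d] binomial_absorb_comp[of d "Suc (2 * k)"] by simp
  ultimately have "Suc (2 * k) * (Suc (Suc (2 * k)) * (d choose Suc (Suc (2 * k))))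
      = (d - Suc (2 * k)) * ((d - 2 * k) * (d choose (2 * k)))"
    by (metis mult.left_commute)
  then have "real (Suc (2 * k)) * (real (Suc (Suc (2 * k))) * real (d choose Suc (Suc (2 * k))))
      = real (d - Suc (2 * k)) * (real (d - 2 * k) * real (d choose (2 * k)))"
    by (metis of_nat_mult)
  \<comment> \<open>For d = 2k the subtraction \<open>d - Suc (2 * k)\<close> is truncated, but the
    factor \<open>d - 2 * k\<close> is 0.\<close>
  also have "\<dots> = (real d - 2 * real k - 1) * (real d - 2 * real k) * real (d choose (2 * k))"
    using assms(2) by (cases "d = 2 * k") (auto simp: of_nat_diff)
  finally have C: "(2 * real k + 1) * (2 * real k + 2) * real (d choose Suc (Suc (2 * k))) = \<dots>"
    by (simp add: ac_simps)
  define P where "P = (\<Prod>j=1..k. 2 * real j - 1)"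
  define Q where "Q = (\<Prod>j=1..k. l - 2 * real d + 2 * real j + 1)"
  have "Q > 0" unfolding Q_def using assms by (intro prod_pos) auto
  have q: "l - 2 * real d + 2 * real k + 3 > 0" using assms by simp
  have "G_coeff l d (Suc k) = real (d choose Suc (Suc (2 * k))) * (P * (2 * real k + 1))
          / (Q * (l - 2 * real d + 2 * real k + 3))"
    by (simp add: G_coeff_def P_def Q_def algebra_simps)
  then have "2 * (real k + 1) * (l - 2 * real d + 2 * real k + 3) * G_coeff l d (Suc k)
      = ((2 * real k + 1) * (2 * real k + 2) * real (d choose Suc (Suc (2 * k)))) * P / Q"
    using q \<open>Q > 0\<close> by (simp add: divide_simps) (simp add: algebra_simps)
  also have "\<dots> = (real d - 2 * real k) * (real d - 2 * real k - 1) * G_coeff l d k"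
    unfolding C by (simp add: G_coeff_def P_def Q_def)
  finally show ?thesis .
qed

text \<open>The coefficient of x^n on the left involves only the coefficients of G of order n and n
  + 2, since n (n - 1) - l n + d (l - d + 1) = (d - n) (l - d - n + 1); its vanishing is
  \<open>G_coeff_Suc\<close>.\<close>

lemma G_poly_ode:
  fixes a l :: real
  assumes "l > 2 * real d - 2"
  defines "G \<equiv> G_poly d a l"
  shows "(a\<^sup>2 + x\<^sup>2) * poly (pderiv (pderiv G)) x - l * x * poly (pderiv G) x
           + real d * (l - real d + 1) * poly G x = 0"
proof -
  have "[:a\<^sup>2, 0, 1:] * pderiv (pderiv G) - smult l ([:0, 1:] * pderiv G)
          + smult (real d * (l - real d + 1)) G = 0" (is "?L = 0")
  proof (rule poly_eqI)
    fix n
    have "coeff ?L n = a\<^sup>2 * ((real n + 2) * (real n + 1)) * coeff G (Suc (Suc n))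
            + (real d - real n) * (l - real d - real n + 1) * coeff G n"
      by (cases n; cases "n - 1") (auto simp: coeff_pderiv coeff_pCons algebra_simps)
    also have "\<dots> = 0"
    proof (cases "n \<le> d \<and> even (d - n)")
      case True
      then obtain i where i: "d = n + 2 * i" by (metis evenE le_add_diff_inverse)
      show ?thesis
      proof (cases i)
        case 0
        then show ?thesis using i by (simp add: G_def coeff_G_poly)
      next
        case (Suc k)
        have "(d - n) div 2 = Suc k" "d - n = Suc (Suc (2 * k))"
          "d - Suc (Suc n) = 2 * k"
          using i Suc by auto
        then have g: "coeff G n = - ((-1) ^ k * a ^ (2 * k) * a\<^sup>2 * G_coeff l d (Suc k))"
          "coeff G (Suc (Suc n)) = (-1) ^ k * a ^ (2 * k) * G_coeff l d k"
          using i Suc by (auto simp: G_def coeff_G_poly power2_eq_square)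
        have dn: "real d = real n + 2 * real k + 2" using i Suc by simp
        have "(real d - real n) * (l - real d - real n + 1) * G_coeff l d (Suc k)
            = (real n + 2) * (real n + 1) * G_coeff l d k"
          using G_coeff_Suc[OF assms(1), of k] i Suc unfolding dn by (simp add: algebra_simps)
        moreover have "a\<^sup>2 * N * (e * h) + X * - (e * a\<^sup>2 * h') = e * a\<^sup>2 * (N * h - X * h')"
          for N e h X h' :: real by (simp add: algebra_simps)
        ultimately show ?thesis unfolding g by simp
      qed
    next
      case False
      then have "coeff G n = 0" "coeff G (Suc (Suc n)) = 0"
        by (auto simp: G_def coeff_G_poly)
      then show ?thesis by simp
    qed
    finally show "coeff ?L n = coeff 0 n" by simp
  qed
  then have "poly ?L x = 0" by simp
  then show ?thesis by (simp add: power2_eq_square algebra_simps)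
qed

section \<open>Real roots of \<open>G\<close> by interlacing\<close>

lemma prod_diff_sign:
  fixes r :: "nat \<Rightarrow> real"
  assumes "strict_mono_on {..<d} r" "k < d"
  shows "(-1) ^ (d - Suc k) * (\<Prod>j\<in>{..<d} - {k}. r k - r j) > 0"
proof -
  have split: "{..<d} - {k} = {..<k} \<union> {k<..<d}" using assms(2) by auto
  have "(\<Prod>j\<in>{..<d} - {k}. r k - r j) = (\<Prod>j<k. r k - r j) * (\<Prod>j\<in>{k<..<d}. r k - r j)"
    unfolding split by (rule prod.union_disjoint) auto
  also have "(\<Prod>j\<in>{k<..<d}. r k - r j) = (\<Prod>j\<in>{k<..<d}. (-1) * (r j - r k))" by simp
  also have "\<dots> = (-1) ^ (d - Suc k) * (\<Prod>j\<in>{k<..<d}. r j - r k)"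
    by (subst prod.distrib) simp
  finally have "(-1) ^ (d - Suc k) * (\<Prod>j\<in>{..<d} - {k}. r k - r j)
      = (\<Prod>j<k. r k - r j) * (\<Prod>j\<in>{k<..<d}. r j - r k)"
    by (simp add: mult.left_commute mult.assoc[symmetric] flip: power_mult_distrib)
  also have "\<dots> > 0"
    using assms by (intro mult_pos_pos prod_pos) (auto simp: strict_mono_on_def)
  finally show ?thesis .
qed

text \<open>
  The nodes \<open>y 1 < \<dots> < y d\<close> are the critical points of \<open>G\<close>, at which the differential equation
  forces \<open>G\<close> and \<open>G''\<close> to have opposite signs.
\<close>

lemma G_poly_real_roots:
  assumes "l > 2 * real d - 2" "a > 0"
  shows "\<exists>r. strict_mono_on {..<d} r \<and> G_poly d a l = (\<Prod>k<d. [:- r k, 1:])"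
  using assms(1)
proof (induction d arbitrary: l)
  case 0
  show ?case by (auto simp: G_poly_def strict_mono_on_def)
next
  case (Suc d)
  define G where "G = G_poly (Suc d) a l"
  obtain r where r: "strict_mono_on {..<d} r" "G_poly d a (l - 2) = (\<Prod>k<d. [:- r k, 1:])"
    using Suc.IH[of "l - 2"] Suc.prems by auto
  have G': "pderiv G = smult (real (Suc d)) (\<Prod>k<d. [:- r k, 1:])"
    using pderiv_G_poly[of d a "l - 2"] r by (simp add: G_def)
  have crit: "(-1) ^ (d - k) * poly G (r k) > 0" if k: "k < d" for k
  proof -
    let ?P = "\<Prod>j\<in>{..<d} - {k}. r k - r j"
    have "poly (pderiv G) (r k) = 0" using k by (auto simp: G' poly_prod)
    moreover have "poly (pderiv (pderiv G)) (r k) = real (Suc d) * ?P"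
      using poly_pderiv_prod_linear(1)[of "{..<d}" r k] k r(1)
      by (simp add: G' pderiv_smult strict_mono_on_imp_inj_on)
    ultimately have "(a\<^sup>2 + (r k)\<^sup>2) * (real (Suc d) * ?P) = - (real (Suc d) * (l - real d) * poly G (r k))"
      using G_poly_ode[OF Suc.prems, of a "r k"] by (simp add: G_def[symmetric])
    then have "real (Suc d) * ((l - real d) * poly G (r k)) = real (Suc d) * (- ((a\<^sup>2 + (r k)\<^sup>2) * ?P))"
      by algebra
    then have "(l - real d) * poly G (r k) = - ((a\<^sup>2 + (r k)\<^sup>2) * ?P)"
      by (subst (asm) mult_cancel_left) (metis of_nat_eq_0_iff nat.distinct(2))
    moreover have "(-1::real) ^ (d - k) = - ((-1) ^ (d - Suc k))"
      using k by (metis Suc_diff_Suc mult_minus1 power_Suc)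
    ultimately have "(l - real d) * ((-1) ^ (d - k) * poly G (r k))
        = (a\<^sup>2 + (r k)\<^sup>2) * ((-1) ^ (d - Suc k) * ?P)"
      by (simp only: mult.left_commute[of "l - real d"] minus_mult_minus mult.left_commute)
    also have "\<dots> > 0"
      by (rule mult_pos_pos[OF _ prod_diff_sign[OF r(1) k]]) (use assms(2) in \<open>simp add: add_pos_nonneg\<close>)
    finally show ?thesis using Suc.prems by (simp add: zero_less_mult_iff)
  qed
  obtain B0 where B0: "poly G x > 0" if "x \<ge> B0" for x
    using poly_pinfty_gt_lc[of G] by (auto simp: G_def lead_coeff_G_poly) (metis less_le_trans zero_less_one)
  \<comment> \<open>All critical points lie in (-B, B) and \<open>G\<close> is positive at
    \<open>B\<close>; the parity of \<open>G\<close> then gives its sign at -B.\<close>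
  define B where "B = max B0 (1 + (\<Sum>k<d. \<bar>r k\<bar>))"
  have "\<bar>r k\<bar> \<le> (\<Sum>k<d. \<bar>r k\<bar>)" if "k < d" for k
    using that by (intro member_le_sum) auto
  then have B: "B \<ge> B0" "B \<ge> 1" "k < d \<Longrightarrow> \<bar>r k\<bar> < B" for k
    unfolding B_def using sum_nonneg[of "{..<d}" "\<lambda>k. \<bar>r k\<bar>"] by force+
  \<comment> \<open>The index is shifted by one to make room for the artificial end nodes -B and
    B.\<close>
  define y where "y i = (if i = 0 then - B else if i = Suc d then B else r (i - 1))" for i
  have y_mono: "y i < y (Suc i)" if "i \<le> d" for i
    using that B r(1) by (auto simp: y_def strict_mono_on_def abs_less_iff minus_less_iff)
  have y_sign: "(-1) ^ (Suc d - i) * poly G (y i) > 0" if "i \<le> Suc d" for i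
  proof -
    have "(-1) ^ Suc d * poly G (- B) = poly G B"
      unfolding G_def poly_G_poly_minus by (simp add: mult.assoc[symmetric] flip: power_mult_distrib)
    then show ?thesis
      using that crit[of "i - 1"] B0[OF B(1)] by (cases i) (auto simp: y_def)
  qed
  \<comment> \<open>The signs alternate from node to node, so each of the \<open>Suc d\<close> gaps
    contains a zero: all that the degree allows.\<close>
  have "\<exists>s. y i < s \<and> s < y (Suc i) \<and> poly G s = 0" if "i \<le> d" for i
  proof -
    define e :: real where "e = (-1) ^ (Suc d - Suc i)"
    have "(-1::real) ^ (Suc d - i) = - e"
      using that by (simp add: e_def Suc_diff_le)
    then have "0 < (- e * poly G (y i)) * (e * poly G (y (Suc i)))"
      using mult_pos_pos[OF y_sign[of i] y_sign[of "Suc i"]] that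
      by (simp only: e_def le_SucI Suc_le_mono)
    also have "\<dots> = - (e * e) * (poly G (y i) * poly G (y (Suc i)))" by simp
    also have "e * e = 1" by (simp add: e_def flip: power_mult_distrib)
    finally have "poly G (y i) * poly G (y (Suc i)) < 0" by simp
    then show ?thesis using poly_IVT[OF y_mono[OF that]] by blast
  qed
  then obtain s where s: "\<And>i. i \<le> d \<Longrightarrow> y i < s i \<and> s i < y (Suc i) \<and> poly G (s i) = 0"
    by metis
  have y_le: "y i \<le> y j" if "i \<le> j" "j \<le> Suc d" for i j
    using that by (induction rule: dec_induct) (auto intro: order_trans less_imp_le[OF y_mono])
  have s_mono: "strict_mono_on {..<Suc d} s"
  proof (rule strict_mono_onI)
    fix i j assume "i \<in> {..<Suc d}" "j \<in> {..<Suc d}" "i < j"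
    then show "s i < s j"
      using s[of i] s[of j] y_le[of "Suc i" j] by simp
  qed
  have "G = (\<Prod>k<Suc d. [:- s k, 1:])" (is "_ = ?P")
  proof (rule poly_eqI_degree_lead_coeff[where n = "Suc d" and A = "s ` {..<Suc d}"])
    have deg: "degree ?P = Suc d" by (subst degree_prod_sum_eq) auto
    have lc: "lead_coeff ?P = 1" by (simp only: lead_coeff_prod) simp
    show "degree ?P \<le> Suc d" "degree G \<le> Suc d" using deg by (auto simp: G_def degree_G_poly)
    show "coeff G (Suc d) = coeff ?P (Suc d)"
      using deg lc lead_coeff_G_poly[of "Suc d" a l] degree_G_poly[of "Suc d" a l] by (simp add: G_def)
    show "Suc d \<le> card (s ` {..<Suc d})"
      using s_mono by (simp add: card_image strict_mono_on_imp_inj_on)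
    fix x assume "x \<in> s ` {..<Suc d}"
    then obtain k where k: "k \<in> {..<Suc d}" "x = s k" by blast
    then have "poly ?P x = 0" unfolding poly_prod by (intro prod_zero) auto
    then show "poly G x = poly ?P x" using s k by simp
  qed
  then show ?case using s_mono unfolding G_def by blast
qed

section \<open>Extremality of the roots of \<open>G\<close>\<close>

text \<open>At a root the differential equation reads (a^2 + r^2) G'' = l r G', a condition on the
  sum of 1 / (r k - r j). Multiplying such a term by (a^2 + (r k)^2) / a and subtracting
  \<open>tan (\<theta> k)\<close> gives the cotangent; the d - 1 subtractions lower the multiplier
  from l to l - 2 (d - 1).\<close>

lemma G_poly_roots_critical:
  assumes l: "l > 2 * real d - 2" and a: "a > 0"
    and r: "strict_mono_on {..<d} r" "G_poly d a l = (\<Prod>k<d. [:- r k, 1:])" and k: "k < d"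
  defines "\<theta> \<equiv> \<lambda>k. arctan (r k / a)"
  shows "2 * (\<Sum>j<d. cot (\<theta> k - \<theta> j)) = (l - 2 * (real d - 1)) * tan (\<theta> k)"
proof -
  define G where "G = G_poly d a l"
  define t where "t j = r j / a" for j
  have inj: "inj_on r {..<d}" using r(1) by (rule strict_mono_on_imp_inj_on)
  have tan: "tan (\<theta> j) = t j" for j by (simp add: \<theta>_def t_def tan_arctan)
  have G': "poly (pderiv G) (r k) = (\<Prod>j\<in>{..<d} - {k}. r k - r j)"
    "poly (pderiv (pderiv G)) (r k) = 2 * poly (pderiv G) (r k) * (\<Sum>j\<in>{..<d} - {k}. 1 / (r k - r j))"
    using poly_pderiv_prod_linear[OF _ inj, of k] k by (simp_all add: G_def r(2))
  have nz: "poly (pderiv G) (r k) \<noteq> 0"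
    unfolding G'(1) using inj k by (auto dest: inj_onD)
  have "poly G (r k) = 0" using k by (auto simp: G_def r(2) poly_prod)
  then have "poly (pderiv G) (r k) * ((a\<^sup>2 + (r k)\<^sup>2) * (2 * (\<Sum>j\<in>{..<d} - {k}. 1 / (r k - r j))))
      = poly (pderiv G) (r k) * (l * r k)"
    using G_poly_ode[OF l, of a "r k", folded G_def] G'(2) by (simp add: mult_ac)
  then have eq: "(a\<^sup>2 + (r k)\<^sup>2) * (2 * (\<Sum>j\<in>{..<d} - {k}. 1 / (r k - r j))) = l * r k"
    using nz by simp
  have "cot (\<theta> k - \<theta> j) = (a\<^sup>2 + (r k)\<^sup>2) / a * (1 / (r k - r j)) - t k" if j: "j \<in> {..<d} - {k}" for j
  proof -
    have "r k \<noteq> r j" using inj j k by (auto dest: inj_onD)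
    then have ne: "t k - t j \<noteq> 0" using a by (simp add: t_def)
    have c: "cos (\<theta> i) \<noteq> 0" for i by (simp add: \<theta>_def)
    have s: "sin (\<theta> i) = t i * cos (\<theta> i)" for i
      using tan[of i] c[of i] by (simp add: tan_def field_simps)
    have "cot (\<theta> k - \<theta> j) = (cos (\<theta> k) * cos (\<theta> j) * (1 + t k * t j)) / (cos (\<theta> k) * cos (\<theta> j) * (t k - t j))"
      by (simp add: cot_def sin_diff cos_diff s algebra_simps)
    also have "\<dots> = (1 + t k * t j) / (t k - t j)" using c by simp
    also have "\<dots> = (1 + (t k)\<^sup>2) / (t k - t j) - t k"
      using ne by (simp add: field_simps power2_eq_square)
    also have "(1 + (t k)\<^sup>2) / (t k - t j) = (a\<^sup>2 + (r k)\<^sup>2) / a * (1 / (r k - r j))"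
      using a \<open>r k \<noteq> r j\<close> by (simp add: t_def divide_simps power2_eq_square)
    finally show ?thesis .
  qed
  then have "(\<Sum>j\<in>{..<d} - {k}. cot (\<theta> k - \<theta> j))
      = (a\<^sup>2 + (r k)\<^sup>2) / a * (\<Sum>j\<in>{..<d} - {k}. 1 / (r k - r j)) - (real d - 1) * t k"
    using k by (simp add: sum_subtractf sum_distrib_left of_nat_diff)
  also have "(a\<^sup>2 + (r k)\<^sup>2) / a * (\<Sum>j\<in>{..<d} - {k}. 1 / (r k - r j)) = l * t k / 2"
    using eq a by (simp add: t_def field_simps)
  finally have "(\<Sum>j\<in>{..<d} - {k}. cot (\<theta> k - \<theta> j)) = l * t k / 2 - (real d - 1) * t k" .
  moreover have "(\<Sum>j<d. cot (\<theta> k - \<theta> j)) = (\<Sum>j\<in>{..<d} - {k}. cot (\<theta> k - \<theta> j))"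
    using k by (subst sum.remove[of _ k]) auto
  ultimately show ?thesis by (simp add: tan algebra_simps)
qed

text \<open>Equal \<open>point_energy\<close> means equal sums of ln cos, so the term with
  multiplier s = l - 2 (d - 1) cancels and the maximum of the penalised energy is a constrained one.
  As s > 0, no rotation remains free and the maximiser is unique.\<close>

lemma pair_energy_le_G_poly_roots:
  assumes l: "l > 2 * real d - 2" and a: "a > 0"
    and r: "strict_mono_on {..<d} r" "G_poly d a l = (\<Prod>k<d. [:- r k, 1:])"
    and S: "finite S" "card S = d" "point_energy a S = point_energy a (r ` {..<d})"
  shows "pair_energy S \<le> pair_energy (r ` {..<d})"
    and "pair_energy S = pair_energy (r ` {..<d}) \<Longrightarrow> S = r ` {..<d}"
proof -
  define \<phi> where "\<phi> k = arctan (r k / a)" for k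
  have \<phi>: "ordered_angles d \<phi>" "r = (\<lambda>k. a * tan (\<phi> k))"
    using ordered_angles_arctan[OF r(1) a] by (simp_all flip: \<phi>_def)
  obtain \<theta> where \<theta>: "ordered_angles d \<theta>" "S = (\<lambda>k. a * tan (\<theta> k)) ` {..<d}"
    using obtain_ordered_angles[of S a] S a by metis
  note o\<theta> = ordered_angles_tan[OF \<theta>(1) a] and o\<phi> = ordered_angles_tan[OF \<phi>(1) a]
  have abs: "(\<Sum>k<d. ln \<bar>cos (\<theta> k)\<bar>) = (\<Sum>k<d. ln (cos (\<theta> k)))"
    "(\<Sum>k<d. ln \<bar>cos (\<phi> k)\<bar>) = (\<Sum>k<d. ln (cos (\<phi> k)))"
    using o\<theta>(1) o\<phi>(1) by (simp_all add: less_imp_le)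
  have nz: "cos (\<theta> k) \<noteq> 0" "cos (\<phi> k) \<noteq> 0" if "k < d" for k
    using o\<theta>(1)[OF that] o\<phi>(1)[OF that] by simp_all
  note P\<theta> = point_energy_tan[OF a nz(1) o\<theta>(2)] pair_energy_tan[OF a nz(1) o\<theta>(2)]
    and P\<phi> = point_energy_tan[OF a nz(2) o\<phi>(2)] pair_energy_tan[OF a nz(2) o\<phi>(2)]
  note P = P\<theta>[unfolded abs, folded \<theta>(2)] P\<phi>[unfolded abs, folded \<phi>(2)]
  have C: "(\<Sum>k<d. ln (cos (\<theta> k))) = (\<Sum>k<d. ln (cos (\<phi> k)))"
    using P(1,3) S(3) by simp
  have E: "pair_energy S - pair_energy (r ` {..<d}) = sin_energy d \<theta> - sin_energy d \<phi>"
    using P(2,4) C by simp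
  define s where "s = l - 2 * (real d - 1)"
  have s: "s > 0" using l by (simp add: s_def)
  note slack = critical_angles_maximal[OF \<theta>(1) \<phi>(1) less_imp_le[OF s]]
  have crit: "2 * (\<Sum>j<d. cot (\<phi> k - \<phi> j)) = s * tan (\<phi> k)" if "k < d" for k
    unfolding s_def \<phi>_def by (rule G_poly_roots_critical[OF l a r that])
  show "pair_energy S \<le> pair_energy (r ` {..<d})"
    using slack(1)[OF crit] E C by simp
  assume "pair_energy S = pair_energy (r ` {..<d})"
  then have "\<theta> k = \<phi> k" if "k < d" for k
    using slack(3)[OF crit] E C s that by simp
  then show "S = r ` {..<d}"
    unfolding \<theta>(2) \<phi>(2) by simp
qed

lemma map_poly_of_real_mult:
  "map_poly complex_of_real (p * q) = map_poly complex_of_real p * map_poly complex_of_real q"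
  by (intro poly_eqI) (simp add: coeff_map_poly coeff_mult)

text \<open>Since (-1)^k * a^(2k) = (ai)^(2k), every term of G(ai) carries the same factor
  (ai)^d.\<close>

lemma poly_G_poly_imaginary:
  assumes r: "G_poly d a l = (\<Prod>k<d. [:- r k, 1:])"
  shows "(\<Prod>k<d. complex_of_real a * \<i> - complex_of_real (r k))
           = (complex_of_real a * \<i>) ^ d * complex_of_real (1 + (\<Sum>k=1..d div 2. G_coeff l d k))"
proof -
  define z where "z = complex_of_real a * \<i>"
  have z2: "z\<^sup>2 = - (complex_of_real a)\<^sup>2"
    by (simp add: z_def power_mult_distrib)
  let ?ev = "\<lambda>p. poly (map_poly complex_of_real p) z"
  have ev_add: "?ev (p + q) = ?ev p + ?ev q" for p q
  proof -
    have "map_poly complex_of_real (p + q) = map_poly complex_of_real p + map_poly complex_of_real q"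
      by (intro poly_eqI) (simp add: coeff_map_poly)
    then show ?thesis by simp
  qed
  have "?ev (\<Sum>k\<in>A. f k) = (\<Sum>k\<in>A. ?ev (f k))" if "finite A" for A :: "nat set" and f
    using that by (induction A rule: finite_induct) (simp_all add: ev_add)
  then have "?ev (G_poly d a l)
      = (\<Sum>k\<le>d div 2. of_real ((-1) ^ k * a ^ (2 * k) * G_coeff l d k) * z ^ (d - 2 * k))"
    by (simp add: G_poly_altdef map_poly_monom poly_monom)
  also have "\<dots> = (\<Sum>k\<le>d div 2. z ^ d * of_real (G_coeff l d k))"
  proof (intro sum.cong refl)
    fix k assume "k \<in> {..d div 2}"
    then have "z ^ d = z ^ (2 * k) * z ^ (d - 2 * k)"
      by (simp flip: power_add)
    moreover have "z ^ (2 * k) = of_real ((-1) ^ k * a ^ (2 * k))"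
      by (simp add: z2 power_mult power_minus[of "(complex_of_real a)\<^sup>2"])
    ultimately show "of_real ((-1) ^ k * a ^ (2 * k) * G_coeff l d k) * z ^ (d - 2 * k)
        = z ^ d * of_real (G_coeff l d k)"
      by (simp add: mult_ac)
  qed
  also have "\<dots> = z ^ d * of_real (1 + (\<Sum>k=1..d div 2. G_coeff l d k))"
    by (simp add: atMost_atLeast0 sum.atLeast_Suc_atMost distrib_left sum_distrib_left)
  finally have "?ev (G_poly d a l) = \<dots>" .
  moreover have "?ev (\<Prod>k\<in>A. [:- r k, 1:]) = (\<Prod>k\<in>A. z - of_real (r k))" if "finite A" for A
    using that by (induction A rule: finite_induct)
      (simp_all only: prod.insert prod.empty map_poly_of_real_mult poly_mult not_False_eq_True,
        simp_all add: map_poly_pCons)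
  ultimately show ?thesis unfolding r z_def by simp
qed

lemma G_coeff_pos:
  assumes "l \<ge> 2 * real d - 2" "2 * k \<le> d"
  shows "G_coeff l d k > 0"
  unfolding G_coeff_def using assms
  by (intro divide_pos_pos mult_pos_pos prod_pos) (auto simp: zero_less_binomial_iff)

text \<open>Take moduli in \<open>poly_G_poly_imaginary\<close>: the bracket is positive, and |ai -
  r| is the square root of a^2 + r^2.\<close>

lemma point_energy_G_poly_roots:
  assumes l: "l > 2 * real d - 2" and a: "a > 0"
    and r: "strict_mono_on {..<d} r" "G_poly d a l = (\<Prod>k<d. [:- r k, 1:])"
  shows "point_energy a (r ` {..<d}) = 2 * ln (a ^ d * (1 + (\<Sum>k=1..d div 2. G_coeff l d k)))"
proof -
  let ?z = "complex_of_real a * \<i>"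
  have "(\<Sum>k=1..d div 2. G_coeff l d k) \<ge> 0"
    using l by (intro sum_nonneg less_imp_le[OF G_coeff_pos]) auto
  then have "cmod (\<Prod>k<d. ?z - complex_of_real (r k)) = a ^ d * (1 + (\<Sum>k=1..d div 2. G_coeff l d k))"
    unfolding poly_G_poly_imaginary[OF r(2)] using a
    by (simp only: norm_mult norm_power norm_of_real norm_ii) simp
  moreover have "ln (cmod (\<Prod>k<d. ?z - complex_of_real (r k))) = (\<Sum>k<d. ln (cmod (?z - complex_of_real (r k))))"
    unfolding prod_norm[symmetric] using a by (subst ln_prod) (auto simp: complex_eq_iff)
  moreover have "ln (cmod (?z - complex_of_real (r k))) = ln (a\<^sup>2 + (r k)\<^sup>2) / 2" for k
    using a by (simp add: cmod_def ln_sqrt add_pos_nonneg add.commute)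
  ultimately show ?thesis
    using r(1) by (simp add: point_energy_def sum.reindex strict_mono_on_imp_inj_on
        sum_divide_distrib[symmetric])
qed

section \<open>Existence and uniqueness of the parameter lambda_e\<close>

lemma G_coeff_strict_antimono:
  assumes "2 * real d - 2 \<le> l" "l < l'" "1 \<le> k" "2 * k \<le> d"
  shows "G_coeff l' d k < G_coeff l d k"
  unfolding G_coeff_def
proof (rule divide_strict_left_mono)
  show "(\<Prod>j=1..k. l - 2 * real d + 2 * real j + 1) < (\<Prod>j=1..k. l' - 2 * real d + 2 * real j + 1)"
    by (rule prod_mono_strict[of 1]) (use assms in auto)
  show "real (d choose (2 * k)) * (\<Prod>j=1..k. 2 * real j - 1) > 0"
    using assms by (intro mult_pos_pos prod_pos) (auto simp: zero_less_binomial_iff)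
  show "(\<Prod>j=1..k. l' - 2 * real d + 2 * real j + 1) * (\<Prod>j=1..k. l - 2 * real d + 2 * real j + 1) > 0"
    using assms by (intro mult_pos_pos prod_pos) auto
qed

lemma sum_G_coeff_strict_antimono:
  assumes "2 * real d - 2 \<le> l" "l < l'" "d \<ge> 2"
  shows "(\<Sum>k=1..d div 2. G_coeff l' d k) < (\<Sum>k=1..d div 2. G_coeff l d k)"
  using assms by (intro sum_strict_mono G_coeff_strict_antimono) auto

text \<open>At this value of \<open>l\<close> the denominator becomes (2k - 1)!! and cancels,
  leaving the sum of the even binomial coefficients. The threshold for \<open>v\<close> encodes this
  end value.\<close>

lemma sum_G_coeff_left_end:
  assumes "d > 0"
  shows "1 + (\<Sum>k=1..d div 2. G_coeff (2 * real d - 2) d k) = 2 ^ (d - 1)"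
proof -
  have "G_coeff (2 * real d - 2) d k = real (d choose (2 * k))" for k
  proof -
    have "(\<Prod>j=1..k. 2 * real d - 2 - 2 * real d + 2 * real j + 1) = (\<Prod>j=1..k. 2 * real j - 1)"
      by (intro prod.cong) auto
    moreover have "(\<Prod>j=1..k. 2 * real j - 1) > 0" by (intro prod_pos) auto
    ultimately show ?thesis by (simp add: G_coeff_def)
  qed
  then have "1 + (\<Sum>k=1..d div 2. G_coeff (2 * real d - 2) d k) = (\<Sum>k\<le>d div 2. real (d choose (2 * k)))"
    by (simp add: atMost_atLeast0 sum.atLeast_Suc_atMost)
  also have "\<dots> = (\<Sum>i\<in>(\<lambda>k. 2 * k) ` {..d div 2}. real (d choose i))"
    by (simp add: sum.reindex inj_on_def)
  also have "\<dots> = (\<Sum>i\<le>d. if even i then real (d choose i) else 0)"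
    by (rule sum.mono_neutral_cong_left) (auto simp: image_iff elim!: evenE)
  finally show ?thesis
    using choose_even_sum[OF assms, where 'a = real] assms by (cases d) auto
qed

lemma sum_G_coeff_tendsto_0:
  "((\<lambda>l. \<Sum>k=1..d div 2. G_coeff l d k) \<longlongrightarrow> 0) at_top"
proof -
  have lim: "((\<lambda>l. c / (l + b)) \<longlongrightarrow> 0) at_top" for b c :: real
    by (rule tendsto_divide_0[OF tendsto_const])
       (use tendsto_add_filterlim_at_infinity[OF tendsto_const
         filterlim_at_top_imp_at_infinity[OF filterlim_ident], of b] in \<open>simp add: add.commute\<close>)
  have "((\<lambda>l. G_coeff l d k) \<longlongrightarrow> 0) at_top" if "1 \<le> k" for k
  proof -
    have "((\<lambda>l. real (d choose (2 * k)) * (\<Prod>j=1..k. (2 * real j - 1) / (l + (2 * real j + 1 - 2 * real d))))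
        \<longlongrightarrow> real (d choose (2 * k)) * (\<Prod>j=1..k. 0)) at_top"
      by (intro tendsto_mult tendsto_const tendsto_prod lim)
    moreover have "G_coeff l d k
        = real (d choose (2 * k)) * (\<Prod>j=1..k. (2 * real j - 1) / (l + (2 * real j + 1 - 2 * real d)))" for l
      by (simp add: G_coeff_def prod_dividef algebra_simps)
    ultimately show ?thesis using that by (simp add: power_0_left)
  qed
  then have "((\<lambda>l. \<Sum>k=1..d div 2. G_coeff l d k) \<longlongrightarrow> (\<Sum>k=1..d div 2. 0)) at_top"
    by (intro tendsto_sum) auto
  then show ?thesis by simp
qed

text \<open>The left side of the defining equation decreases strictly from 2^(d-1) at l = 2d - 2 to
  the limit 1 at infinity, and the two bounds on \<open>v\<close> place the target value
  \<open>M\<close> strictly between.\<close>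

lemma ex1_lambda_e:
  assumes a: "a > 0" and d: "d \<ge> 2" and v: "v < - ln a" "(1 / real d - 1) * ln 2 - ln a < v"
  shows "\<exists>!l. is_lambda_e a d v l"
proof -
  let ?h = "\<lambda>l. 1 + (\<Sum>k=1..d div 2. G_coeff l d k)"
  define M where "M = exp (- v * real d) / a ^ d"
  have M0: "M > 0" using a by (simp add: M_def)
  have lnM: "ln M = - real d * (v + ln a)"
    using a by (simp add: M_def ln_div ln_realpow algebra_simps)
  have "ln M > 0" unfolding lnM using v(1) d by (simp add: mult_less_0_iff)
  then have M1: "M > 1" using M0 by (simp add: ln_gt_zero_iff)
  have "real d * ((1 / real d - 1) * ln 2 - ln a) < real d * v"
    using v(2) d by (intro mult_strict_left_mono) auto
  then have "ln M < (real d - 1) * ln 2"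
    unfolding lnM using d by (simp add: algebra_simps)
  also have "\<dots> = ln (2 ^ (d - 1))" using d by (simp add: ln_realpow of_nat_diff)
  finally have M2: "M < 2 ^ (d - 1)" using M0 by simp
  have "eventually (\<lambda>l. (\<Sum>k=1..d div 2. G_coeff l d k) < M - 1) at_top"
    using order_tendstoD(2)[OF sum_G_coeff_tendsto_0, of "M - 1"] M1 by simp
  then obtain L where L: "L \<ge> 2 * real d - 2" "?h L < M"
    using eventually_happens'[OF _ eventually_conj[OF eventually_ge_at_top[of "2 * real d - 2"]]]
    by (smt (verit, ccfv_threshold) trivial_limit_at_top_linorder)
  have "continuous_on {2 * real d - 2..L} ?h"
    unfolding G_coeff_def
    by (intro continuous_intros) (auto simp: prod_zero_iff)
  then obtain l where l: "2 * real d - 2 \<le> l" "?h l = M"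
    using IVT2'[of ?h L M "2 * real d - 2"] L M2 sum_G_coeff_left_end[of d] d by auto
  \<comment> \<open>The intermediate value theorem allows the left end point, which
    \<open>is_lambda_e\<close> excludes; there the value is 2^(d-1) > M.\<close>
  have "l \<noteq> 2 * real d - 2" using l M2 sum_G_coeff_left_end[of d] d by auto
  then have "is_lambda_e a d v l" using l by (simp add: is_lambda_e_def M_def)
  moreover have "l' = l''" if "is_lambda_e a d v l'" "is_lambda_e a d v l''" for l' l''
    using that sum_G_coeff_strict_antimono[of d l' l''] sum_G_coeff_strict_antimono[of d l'' l'] d
    by (cases l' l'' rule: linorder_cases) (auto simp: is_lambda_e_def)
  ultimately show ?thesis by blast
qed

section \<open>Translation to the discrete energy\<close>

lemma tan_points_eq_spaced_tans:
  assumes "d > 0"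
  shows "tan_points a d v = spaced_tans a d (tan_gamma a d v)"
proof -
  have "{0..d - 1} = {..<d}" using assms by auto
  then show ?thesis by (simp add: tan_points_def spaced_tans_def)
qed

lemma
  assumes d: "d \<ge> 2" and inj: "inj_on x {1..d}"
  shows discrete_energy_ge_iff:
      "discrete_energy d x \<ge> ereal e \<longleftrightarrow> pair_energy (x ` {1..d}) \<le> - (real d * (real d - 1) * e)"
    and discrete_energy_eq_iff:
      "discrete_energy d x = ereal e \<longleftrightarrow> pair_energy (x ` {1..d}) = - (real d * (real d - 1) * e)"
proof -
  define c where "c = real d * (real d - 1)"
  have c: "c > 0" using d by (simp add: c_def)
  have E: "discrete_energy d x = ereal (- pair_energy (x ` {1..d}) / c)"
    by (simp add: discrete_energy_inj[OF inj] c_def)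
  show "discrete_energy d x \<ge> ereal e \<longleftrightarrow> pair_energy (x ` {1..d}) \<le> - (real d * (real d - 1) * e)"
    unfolding E c_def[symmetric] using c by (auto simp: field_simps)
  show "discrete_energy d x = ereal e \<longleftrightarrow> pair_energy (x ` {1..d}) = - (real d * (real d - 1) * e)"
    unfolding E c_def[symmetric] using c by (auto simp: field_simps)
qed

lemma discrete_energy_eq_ereal_imp_inj:
  "discrete_energy d x = ereal e \<Longrightarrow> inj_on x {1..d}"
  by (simp add: discrete_energy_def split: if_splits)

text \<open>Both sides are read off from the energy of the points \<open>r (k - 1)\<close>, indexed
  from 1 to d: once through the discriminant and once through \<open>pair_energy\<close>.\<close>

lemma discriminant_strict_mono_roots:
  fixes r :: "nat \<Rightarrow> real"
  assumes "strict_mono_on {..<d} r" "d \<ge> 2"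
  shows "ln (discriminant (\<Prod>k<d. [:- r k, 1:])) = pair_energy (r ` {..<d})"
proof -
  define x where "x k = r (k - 1)" for k
  have bij: "bij_betw (\<lambda>k. k - 1) {1..d} {..<d}"
    by (rule bij_betw_byWitness[where f' = Suc]) auto
  have im: "x ` {1..d} = r ` {..<d}"
    unfolding x_def using bij_betw_imp_surj_on[OF bij] by (metis image_image)
  have inj: "inj_on x {1..d}"
    unfolding x_def using comp_inj_on[of "\<lambda>k. k - 1" "{1..d}" r] bij assms(1)
    by (auto simp: bij_betw_def o_def strict_mono_on_imp_inj_on)
  have "(\<Prod>k=1..d. [:- x k, 1:]) = (\<Prod>k<d. [:- r k, 1:])"
    unfolding x_def by (rule prod.reindex_bij_betw[OF bij])
  then show ?thesis
    using discrete_energy_eq_discriminant[OF inj] discrete_energy_inj[OF inj] assms(2)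
    by (simp add: divide_simps flip: im)
qed

text \<open>A multiset without repetitions forces distinct points; this is how a labelled
  configuration is compared with a list of simple roots.\<close>

lemma image_mset_eq_mset_set_iff:
  assumes "finite A" "finite T"
  shows "image_mset x (mset_set A) = mset_set T \<longleftrightarrow> inj_on x A \<and> x ` A = T"
proof
  assume L: "image_mset x (mset_set A) = mset_set T"
  have im: "x ` A = T"
    using arg_cong[OF L, of set_mset] assms by simp
  moreover have "card A = card T" using arg_cong[OF L, of size] by simp
  ultimately show "inj_on x A \<and> x ` A = T" using assms(1) by (simp add: eq_card_imp_inj_on)
next
  assume "inj_on x A \<and> x ` A = T"
  then show "image_mset x (mset_set A) = mset_set T" by (auto simp: image_mset_mset_set)
qed

lemma proots_prod_linear:
  fixes r :: "'b \<Rightarrow> 'a :: idom"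
  assumes "finite A" "inj_on r A"
  shows "proots (\<Prod>k\<in>A. [:- r k, 1:]) = mset_set (r ` A)"
proof -
  have "proots (\<Prod>k\<in>A. [:- r k, 1:]) = (\<Sum>k\<in>A. {#r k#})"
    by (simp add: proots_prod)
  also have "\<dots> = image_mset r (mset_set A)"
    using assms(1) by (induction A rule: finite_induct) auto
  also have "\<dots> = mset_set (r ` A)" by (rule image_mset_mset_set[OF assms(2)])
  finally show ?thesis .
qed

theorem theorem9:
  fixes a v :: real and d :: nat
  assumes "a > 0" and "d \<ge> 2" and "v < - ln a"
  shows
    "(\<forall>x. log_potential (counting_prob d x) (complex_of_real a * \<i>) = v \<longrightarrow>
         discrete_energy d x \<ge> ereal (2 * v + ln (2 * a) - ln (real d) / (real d - 1)))
     \<and>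
     (v \<le> (1 / real d - 1) * ln 2 - ln a \<longrightarrow>
       (\<forall>x. log_potential (counting_prob d x) (complex_of_real a * \<i>) = v \<and>
            discrete_energy d x = ereal (2 * v + ln (2 * a) - ln (real d) / (real d - 1))
          \<longleftrightarrow> x ` {1..d} = tan_points a d v \<or> x ` {1..d} = uminus ` tan_points a d v))
     \<and>
     ((1 / real d - 1) * ln 2 - ln a < v \<longrightarrow>
       (\<exists>!l. is_lambda_e a d v l) \<and>
       (\<forall>l. is_lambda_e a d v l \<longrightarrow>
         (\<forall>x. log_potential (counting_prob d x) (complex_of_real a * \<i>) = v \<longrightarrow>
            discrete_energy d x
              \<ge> ereal (- ln (discriminant (G_poly d a l)) / (real d * (real d - 1)))) \<and>
         (\<forall>x. log_potential (counting_prob d x) (complex_of_real a * \<i>) = v \<and>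
              discrete_energy d x
                = ereal (- ln (discriminant (G_poly d a l)) / (real d * (real d - 1)))
            \<longleftrightarrow> image_mset x (mset_set {1..d}) = proots (G_poly d a l))))"
proof -
  let ?pot = "\<lambda>x. log_potential (counting_prob d x) (complex_of_real a * \<i>)"
  have d0: "d > 0" using assms(2) by simp
  note pot = log_potential_eq_iff_inj[OF assms(1) d0]
  note ge = discrete_energy_ge_iff[OF assms(2)] and eq = discrete_energy_eq_iff[OF assms(2)]
  \<comment> \<open>Coinciding points have infinite energy and so satisfy every lower bound.\<close>
  have inf: "discrete_energy d x \<ge> ereal e" if "\<not> inj_on x {1..d}" for x e
    using that by (simp add: discrete_energy_def)
  have card: "card (x ` {1..d}) = d" if "inj_on x {1..d}" for x :: "nat \<Rightarrow> real"
    using card_image[OF that] by simp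
  define e where "e = 2 * v + ln (2 * a) - ln (real d) / (real d - 1)"
  \<comment> \<open>Scaling by -d (d - 1) turns the lower bound for the energy into the upper bound
    of \<open>pair_energy_le\<close>.\<close>
  have e: "- (real d * (real d - 1) * e)
      = real d * ln (real d) - real d * (real d - 1) * (2 * v + ln (2 * a))"
    using assms(2) by (simp add: e_def field_simps)
  have part1: "discrete_energy d x \<ge> ereal e" if "?pot x = v" for x
  proof (cases "inj_on x {1..d}")
    case True
    then show ?thesis
      using pair_energy_le(1)[OF _ card d0 assms(1)] pot that by (simp add: ge e)
  qed (rule inf)
  have part2: "?pot x = v \<and> discrete_energy d x = ereal e
      \<longleftrightarrow> x ` {1..d} = tan_points a d v \<or> x ` {1..d} = uminus ` tan_points a d v"
    (is "?L \<longleftrightarrow> ?R")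
    if v: "v \<le> (1 / real d - 1) * ln 2 - ln a" for x
  proof -
    note max = pair_energy_max_iff[OF assms(1,2) v, of "x ` {1..d}",
        folded tan_points_eq_spaced_tans[OF d0] e]
    show ?thesis
    proof
      assume L: ?L
      then have inj: "inj_on x {1..d}" using discrete_energy_eq_ereal_imp_inj by blast
      show ?R
        unfolding max[symmetric] using L card[OF inj] pot[OF inj] eq[OF inj] by simp
    next
      assume ?R
      then have *: "card (x ` {1..d}) = d \<and> point_energy a (x ` {1..d}) = - 2 * real d * v
          \<and> pair_energy (x ` {1..d}) = - (real d * (real d - 1) * e)"
        unfolding max .
      \<comment> \<open>Only the image is given; since it has \<open>d\<close> elements, the points
        are distinct.\<close>
      then have "inj_on x {1..d}" by (intro eq_card_imp_inj_on) auto
      with * show ?L by (simp add: pot eq)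
    qed
  qed
  have part3: "(?pot x = v \<longrightarrow> discrete_energy d x
          \<ge> ereal (- ln (discriminant (G_poly d a l)) / (real d * (real d - 1))))
      \<and> (?pot x = v \<and> discrete_energy d x
          = ereal (- ln (discriminant (G_poly d a l)) / (real d * (real d - 1)))
        \<longleftrightarrow> image_mset x (mset_set {1..d}) = proots (G_poly d a l))"
    if l: "is_lambda_e a d v l" for x l
  proof -
    have l2: "l > 2 * real d - 2" using l by (simp add: is_lambda_e_def)
    obtain r where r: "strict_mono_on {..<d} r" "G_poly d a l = (\<Prod>k<d. [:- r k, 1:])"
      using G_poly_real_roots[OF l2 assms(1)] by blast
    define T where "T = r ` {..<d}"
    have inj_r: "inj_on r {..<d}" using r(1) by (rule strict_mono_on_imp_inj_on)
    have T: "finite T" "card T = d" by (simp_all add: T_def card_image[OF inj_r])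
    have "1 + (\<Sum>k=1..d div 2. G_coeff l d k) = exp (- v * real d) / a ^ d"
      using l by (simp add: is_lambda_e_def)
    then have pT: "point_energy a T = - 2 * real d * v"
      using point_energy_G_poly_roots[OF l2 assms(1) r] assms(1) by (simp add: T_def)
    define c where "c = - ln (discriminant (G_poly d a l)) / (real d * (real d - 1))"
    have c: "- (real d * (real d - 1) * c) = pair_energy T"
      using discriminant_strict_mono_roots[OF r(1) assms(2)] assms(2)
      by (simp add: c_def r(2) T_def)
    have le: "pair_energy (x ` {1..d}) \<le> pair_energy T"
      "pair_energy (x ` {1..d}) = pair_energy T \<Longrightarrow> x ` {1..d} = T"
      if "inj_on x {1..d}" "?pot x = v"
      using pair_energy_le_G_poly_roots[OF l2 assms(1) r _ card[OF that(1)], folded T_def]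
        pot[OF that(1)] that(2) pT by auto
    have "?pot x = v \<longrightarrow> discrete_energy d x \<ge> ereal c"
      using le(1) inf by (cases "inj_on x {1..d}") (simp_all add: ge c)
    moreover have "?pot x = v \<and> discrete_energy d x = ereal c
        \<longleftrightarrow> image_mset x (mset_set {1..d}) = proots (G_poly d a l)"
    proof -
      have "proots (G_poly d a l) = mset_set T"
        unfolding r(2) T_def by (rule proots_prod_linear[OF _ inj_r]) simp
      then have "image_mset x (mset_set {1..d}) = proots (G_poly d a l)
          \<longleftrightarrow> inj_on x {1..d} \<and> x ` {1..d} = T"
        using T(1) by (simp add: image_mset_eq_mset_set_iff)
      also have "\<dots> \<longleftrightarrow> ?pot x = v \<and> discrete_energy d x = ereal c"
      proof
        assume "inj_on x {1..d} \<and> x ` {1..d} = T"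
        then show "?pot x = v \<and> discrete_energy d x = ereal c"
          using pT by (simp add: pot eq c)
      next
        assume *: "?pot x = v \<and> discrete_energy d x = ereal c"
        then have "inj_on x {1..d}" using discrete_energy_eq_ereal_imp_inj by blast
        with * show "inj_on x {1..d} \<and> x ` {1..d} = T"
          using le(2) by (simp add: eq c)
      qed
      finally show ?thesis by blast
    qed
    ultimately show ?thesis unfolding c_def by blast
  qed
  show ?thesis
    using part1 part2 part3 ex1_lambda_e[OF assms] unfolding e_def by blast
qed

end
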